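(* Let $d\ge 1$ be an integer. There is no double structure on the rational normal curve of degree $d$ in $\mathbb{P}^d$ whose homogeneous ideal is generated by quadrics and has only linear syzygies.
   Context: All schemes are algebraic schemes over a fixed algebraically closed field $k$. The rational normal curve of degree $d$ in $\mathbb{P}^d$ is the image of $\mathbb{P}^1$ under the degree $d$ Veronese embedding. Double structure (Ferrand doubling): let $X\subset\mathbb{P}^n$ be a smooth curve with ideal sheaf $\mathscr{I}$. A double structure $Y$ on $X$ in $\mathbb{P}^n$ is a closed subscheme $Y\subset\mathbb{P}^n$ whose ideal sheaf is $\mathscr{J}=\ker(\mathscr{I}\to\mathscr{I}/\mathscr{I}^2\xrightarrow{p}\mathcal{L})$, where $\mathcal{L}$ is a line bundle on $X$ and $p$ is a surjective homomorphism. The homogeneous ideal of $Y$ is $J=\bigoplus_{\ell\ge 0}H^0(\mathscr{J}(\ell))\subset R=k[X_0,\dots,X_n]$. It is generated by quadrics and has only linear syzygies if its minimal graded free resolution has the form $0\leftarrow J\leftarrow b_1R(-2)\leftarrow b_2R(-3)\leftarrow b_3R(-4)\leftarrow\cdots$, where $bR(-j)$ is a direct sum of $b$ copies of $R(-j)$. *)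

theory Defs
  imports
    "HOL-Analysis.Function_Topology"
    "HOL-Library.Poly_Mapping"
    "HOL-Computational_Algebra.Polynomial"
    "HOL-Algebra.Module"
    "HOL-Algebra.Ideal_Product"
begin

section \<open>Polynomials in the variables with index at most n\<close>

type_synonym 'k mpoly = "(nat \<Rightarrow>\<^sub>0 nat) \<Rightarrow>\<^sub>0 'k"

definition mon_degree :: "(nat \<Rightarrow>\<^sub>0 nat) \<Rightarrow> nat" where
  "mon_degree m = (\<Sum>i\<in>Poly_Mapping.keys m. Poly_Mapping.lookup m i)"

definition peval :: "'k::field mpoly \<Rightarrow> (nat \<Rightarrow> 'k) \<Rightarrow> 'k" where
  "peval f v = (\<Sum>m\<in>Poly_Mapping.keys f. Poly_Mapping.lookup f m * (\<Prod>i\<in>Poly_Mapping.keys m. v i ^ Poly_Mapping.lookup m i))"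

definition poly_ring :: "nat \<Rightarrow> 'k::field mpoly set" where
  "poly_ring n = {f. \<forall>m\<in>Poly_Mapping.keys f. Poly_Mapping.keys m \<subseteq> {..n}}"

definition forms :: "nat \<Rightarrow> nat \<Rightarrow> 'k::field mpoly set" where
  "forms n l = {f \<in> poly_ring n. \<forall>m\<in>Poly_Mapping.keys f. mon_degree m = l}"


section \<open>Projective space\<close>

text \<open>
  The schemes are of finite type over an algebraically closed field, and the ambient spaces
  are reduced. They are represented by their closed points, with sections of the structure sheaf
  as functions on closed points. The open sets of the scheme and those of its space of closed
  points correspond bijectively, so sheaves on the two spaces are the same.

  A point is the set of all its homogeneous coordinate vectors. A vector has coordinates
  0, ..., n and is extended by 0.
\<close>

type_synonym 'k point = "(nat \<Rightarrow> 'k) set"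

definition coords :: "nat \<Rightarrow> (nat \<Rightarrow> 'k::field) set" where
  "coords n = {v. (\<forall>i>n. v i = 0) \<and> (\<exists>i. v i \<noteq> 0)}"

definition proj_point :: "(nat \<Rightarrow> 'k::field) \<Rightarrow> 'k point" where
  "proj_point v = {\<lambda>i. c * v i | c. c \<noteq> 0}"

definition proj_space :: "nat \<Rightarrow> 'k::field point set" where
  "proj_space n = proj_point ` coords n"

definition basic_open :: "nat \<Rightarrow> 'k::field mpoly \<Rightarrow> 'k point set" where
  "basic_open n f = {P \<in> proj_space n. \<forall>v\<in>P. peval f v \<noteq> 0}"

definition zariski :: "nat \<Rightarrow> 'k::field point topology" where
  "zariski n = topology_generated_by {basic_open n f | f l. f \<in> forms n l}"

text \<open>
  Regular functions on a locally closed subset W of projective space. As W may be open or closed,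
  this gives both the structure sheaf of projective space and that of a reduced closed subscheme.
\<close>

definition regular :: "nat \<Rightarrow> 'k::field point set \<Rightarrow> ('k point \<Rightarrow> 'k) set" where
  "regular n W = {f \<in> extensional W. \<forall>P\<in>W. \<exists>N l a b.
     openin (zariski n) N \<and> P \<in> N \<and> a \<in> forms n l \<and> b \<in> forms n l \<and>
     (\<forall>Q\<in>N \<inter> W. \<forall>v\<in>Q. peval b v \<noteq> 0 \<and> f Q = peval a v / peval b v)}"

definition str_sheaf :: "nat \<Rightarrow> 'k::field point set \<Rightarrow> ('k point \<Rightarrow> 'k) ring" where
  "str_sheaf n W =
    \<lparr>carrier = regular n W,
     mult = (\<lambda>f g. \<lambda>P\<in>W. f P * g P),
     one = (\<lambda>P\<in>W. 1),
     zero = (\<lambda>P\<in>W. 0),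
     add = (\<lambda>f g. \<lambda>P\<in>W. f P + g P)\<rparr>"


section \<open>Sheaves of modules\<close>

text \<open>
  Throughout, \<O> is a sheaf of rings on T whose sections are functions, with restriction of
  functions as restriction map.
\<close>

type_synonym ('p, 'k) fun_sheaf = "'p set \<Rightarrow> ('p \<Rightarrow> 'k) ring"

record ('p, 'k, 'm) module_sheaf =
  Sec :: "'p set \<Rightarrow> ('p \<Rightarrow> 'k, 'm) module"
  Res :: "'p set \<Rightarrow> 'p set \<Rightarrow> 'm \<Rightarrow> 'm"

definition is_module_sheaf ::
  "'p topology \<Rightarrow> ('p, 'k) fun_sheaf \<Rightarrow> ('p, 'k, 'm) module_sheaf \<Rightarrow> bool" where
  "is_module_sheaf T \<O> S \<longleftrightarrow>
    (\<forall>U. openin T U \<longrightarrow> Module.module (\<O> U) (Sec S U)) \<and>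
    (\<forall>U V. openin T U \<and> openin T V \<and> V \<subseteq> U \<longrightarrow>
      Res S U V \<in> carrier (Sec S U) \<rightarrow> carrier (Sec S V) \<and>
      (\<forall>s\<in>carrier (Sec S U). \<forall>t\<in>carrier (Sec S U).
        Res S U V (s \<oplus>\<^bsub>Sec S U\<^esub> t) = Res S U V s \<oplus>\<^bsub>Sec S V\<^esub> Res S U V t) \<and>
      (\<forall>a\<in>carrier (\<O> U). \<forall>s\<in>carrier (Sec S U).
        Res S U V (a \<odot>\<^bsub>Sec S U\<^esub> s) = restrict a V \<odot>\<^bsub>Sec S V\<^esub> Res S U V s)) \<and>
    (\<forall>U s. openin T U \<and> s \<in> carrier (Sec S U) \<longrightarrow> Res S U U s = s) \<and>
    (\<forall>U V W s. openin T U \<and> openin T V \<and> openin T W \<and> W \<subseteq> V \<and> V \<subseteq> U \<and>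
      s \<in> carrier (Sec S U) \<longrightarrow> Res S V W (Res S U V s) = Res S U W s) \<and>
    (\<forall>\<U> s t. (\<forall>V\<in>\<U>. openin T V) \<and>
      s \<in> carrier (Sec S (\<Union>\<U>)) \<and> t \<in> carrier (Sec S (\<Union>\<U>)) \<and>
      (\<forall>V\<in>\<U>. Res S (\<Union>\<U>) V s = Res S (\<Union>\<U>) V t) \<longrightarrow> s = t) \<and>
    (\<forall>\<U> \<sigma>. (\<forall>V\<in>\<U>. openin T V \<and> \<sigma> V \<in> carrier (Sec S V)) \<and>
      (\<forall>V\<in>\<U>. \<forall>W\<in>\<U>. Res S V (V \<inter> W) (\<sigma> V) = Res S W (V \<inter> W) (\<sigma> W)) \<longrightarrow>
      (\<exists>s\<in>carrier (Sec S (\<Union>\<U>)). \<forall>V\<in>\<U>. Res S (\<Union>\<U>) V s = \<sigma> V))"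

definition module_sheaf_hom ::
  "'p topology \<Rightarrow> ('p, 'k) fun_sheaf \<Rightarrow> ('p, 'k, 'm) module_sheaf \<Rightarrow> ('p, 'k, 'l) module_sheaf
    \<Rightarrow> ('p set \<Rightarrow> 'm \<Rightarrow> 'l) \<Rightarrow> bool" where
  "module_sheaf_hom T \<O> S S' \<phi> \<longleftrightarrow>
    (\<forall>U. openin T U \<longrightarrow>
      \<phi> U \<in> carrier (Sec S U) \<rightarrow> carrier (Sec S' U) \<and>
      (\<forall>s\<in>carrier (Sec S U). \<forall>t\<in>carrier (Sec S U).
        \<phi> U (s \<oplus>\<^bsub>Sec S U\<^esub> t) = \<phi> U s \<oplus>\<^bsub>Sec S' U\<^esub> \<phi> U t) \<and>
      (\<forall>a\<in>carrier (\<O> U). \<forall>s\<in>carrier (Sec S U).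
        \<phi> U (a \<odot>\<^bsub>Sec S U\<^esub> s) = a \<odot>\<^bsub>Sec S' U\<^esub> \<phi> U s)) \<and>
    (\<forall>U V. openin T U \<and> openin T V \<and> V \<subseteq> U \<longrightarrow>
      (\<forall>s\<in>carrier (Sec S U). \<phi> V (Res S U V s) = Res S' U V (\<phi> U s)))"

text \<open>Surjectivity on stalks, not on sections.\<close>

definition surjective_sheaf_map ::
  "'p topology \<Rightarrow> ('p, 'k, 'm) module_sheaf \<Rightarrow> ('p, 'k, 'l) module_sheaf
    \<Rightarrow> ('p set \<Rightarrow> 'm \<Rightarrow> 'l) \<Rightarrow> bool" where
  "surjective_sheaf_map T S S' \<phi> \<longleftrightarrow>
    (\<forall>U t P. openin T U \<and> t \<in> carrier (Sec S' U) \<and> P \<in> U \<longrightarrow>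
      (\<exists>V s. openin T V \<and> P \<in> V \<and> V \<subseteq> U \<and> s \<in> carrier (Sec S V) \<and> \<phi> V s = Res S' U V t))"

definition free_rank_one :: "('p, 'k) fun_sheaf \<Rightarrow> ('p, 'k, 'p \<Rightarrow> 'k) module_sheaf" where
  "free_rank_one \<O> =
    \<lparr>Sec = (\<lambda>U. \<lparr>carrier = carrier (\<O> U), mult = mult (\<O> U), one = one (\<O> U),
                 zero = zero (\<O> U), add = add (\<O> U), smult = mult (\<O> U)\<rparr>),
     Res = (\<lambda>U V f. restrict f V)\<rparr>"

definition line_bundle ::
  "'p topology \<Rightarrow> ('p, 'k) fun_sheaf \<Rightarrow> ('p, 'k, 'm) module_sheaf \<Rightarrow> bool" where
  "line_bundle T \<O> L \<longleftrightarrow> is_module_sheaf T \<O> L \<and>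
    (\<forall>P\<in>topspace T. \<exists>W \<phi>. openin T W \<and> P \<in> W \<and>
      module_sheaf_hom (subtopology T W) \<O> (free_rank_one \<O>) L \<phi> \<and>
      (\<forall>U. openin (subtopology T W) U \<longrightarrow>
        bij_betw (\<phi> U) (carrier (Sec (free_rank_one \<O>) U)) (carrier (Sec L U))))"

text \<open>
  Direct image along the inclusion of X, as a sheaf of modules over the structure sheaf of
  the ambient space.
\<close>

definition push_forward ::
  "'p set \<Rightarrow> ('p, 'k, 'm) module_sheaf \<Rightarrow> ('p, 'k, 'm) module_sheaf" where
  "push_forward X L =
    \<lparr>Sec = (\<lambda>U. (Sec L (U \<inter> X))\<lparr>smult := (\<lambda>a s. restrict a (U \<inter> X) \<odot>\<^bsub>Sec L (U \<inter> X)\<^esub> s)\<rparr>),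
     Res = (\<lambda>U V. Res L (U \<inter> X) (V \<inter> X))\<rparr>"


section \<open>Quotients of ideal sheaves\<close>

text \<open>
  For ideal sheaves G and F with G contained in F, the quotient sheaf F/G. A germ of F/G at P is a
  class of local sections (V, f) of F, two of them being identified if they differ by
  a section of G near P. A section of F/G is a family of germs that is locally induced by
  sections of F.
\<close>

type_synonym ('p, 'k) ideal_sheaf = "'p set \<Rightarrow> ('p \<Rightarrow> 'k) set"

type_synonym ('p, 'k) germ = "('p set \<times> ('p \<Rightarrow> 'k)) set"

definition quot_germ ::
  "'p topology \<Rightarrow> ('p, 'k::field) ideal_sheaf \<Rightarrow> ('p, 'k) ideal_sheaf
    \<Rightarrow> 'p \<Rightarrow> 'p set \<Rightarrow> ('p \<Rightarrow> 'k) \<Rightarrow> ('p, 'k) germ" where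
  "quot_germ T F G P V f =
    {(W, g). openin T W \<and> P \<in> W \<and> g \<in> F W \<and>
       (\<exists>Z. openin T Z \<and> P \<in> Z \<and> Z \<subseteq> V \<inter> W \<and> (\<lambda>Q\<in>Z. f Q - g Q) \<in> G Z)}"

definition quot_proj ::
  "'p topology \<Rightarrow> ('p, 'k::field) ideal_sheaf \<Rightarrow> ('p, 'k) ideal_sheaf
    \<Rightarrow> 'p set \<Rightarrow> ('p \<Rightarrow> 'k) \<Rightarrow> 'p \<Rightarrow> ('p, 'k) germ" where
  "quot_proj T F G U f = (\<lambda>P\<in>U. quot_germ T F G P U f)"

definition quot_sections ::
  "'p topology \<Rightarrow> ('p, 'k::field) ideal_sheaf \<Rightarrow> ('p, 'k) ideal_sheaf
    \<Rightarrow> 'p set \<Rightarrow> ('p \<Rightarrow> ('p, 'k) germ) set" where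
  "quot_sections T F G U =
    {s \<in> extensional U. \<forall>P\<in>U. \<exists>V f. openin T V \<and> P \<in> V \<and> V \<subseteq> U \<and> f \<in> F V \<and>
       (\<forall>Q\<in>V. s Q = quot_germ T F G Q V f)}"

definition quot_add ::
  "'p topology \<Rightarrow> ('p, 'k::field) ideal_sheaf \<Rightarrow> ('p, 'k) ideal_sheaf
    \<Rightarrow> 'p \<Rightarrow> ('p, 'k) germ \<Rightarrow> ('p, 'k) germ \<Rightarrow> ('p, 'k) germ" where
  "quot_add T F G P A B =
    (\<Union>(V, f)\<in>A. \<Union>(W, g)\<in>B. quot_germ T F G P (V \<inter> W) (\<lambda>Q\<in>V \<inter> W. f Q + g Q))"

definition quot_smult ::
  "'p topology \<Rightarrow> ('p, 'k::field) ideal_sheaf \<Rightarrow> ('p, 'k) ideal_sheaf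
    \<Rightarrow> 'p set \<Rightarrow> ('p \<Rightarrow> 'k) \<Rightarrow> 'p \<Rightarrow> ('p, 'k) germ \<Rightarrow> ('p, 'k) germ" where
  "quot_smult T F G U a P A =
    (\<Union>(V, f)\<in>A. quot_germ T F G P (U \<inter> V) (\<lambda>Q\<in>U \<inter> V. a Q * f Q))"

text \<open>The fields \<open>mult\<close> and \<open>one\<close> of a module record play no role.\<close>

definition quot_sheaf ::
  "'p topology \<Rightarrow> ('p, 'k::field) ideal_sheaf \<Rightarrow> ('p, 'k) ideal_sheaf
    \<Rightarrow> ('p, 'k, 'p \<Rightarrow> ('p, 'k) germ) module_sheaf" where
  "quot_sheaf T F G =
    \<lparr>Sec = (\<lambda>U. \<lparr>carrier = quot_sections T F G U,
                 mult = undefined,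
                 one = undefined,
                 zero = quot_proj T F G U (\<lambda>P\<in>U. 0),
                 add = (\<lambda>s t. \<lambda>P\<in>U. quot_add T F G P (s P) (t P)),
                 smult = (\<lambda>a s. \<lambda>P\<in>U. quot_smult T F G U a P (s P))\<rparr>),
     Res = (\<lambda>U V s. restrict s V)\<rparr>"


section \<open>Double structures\<close>

definition vanishing_ideal :: "nat \<Rightarrow> 'k::field point set \<Rightarrow> ('k point, 'k) ideal_sheaf" where
  "vanishing_ideal n X U = {f \<in> regular n U. \<forall>P\<in>U \<inter> X. f P = 0}"

text \<open>The square of an ideal sheaf is the sheaf associated with the squares of ideals.\<close>

definition ideal_square :: "nat \<Rightarrow> ('k::field point, 'k) ideal_sheaf \<Rightarrow> ('k point, 'k) ideal_sheaf"
  where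
  "ideal_square n F U = {f \<in> regular n U. \<forall>P\<in>U. \<exists>V. openin (zariski n) V \<and> P \<in> V \<and> V \<subseteq> U \<and>
     restrict f V \<in> ideal_prod (str_sheaf n V) (F V) (F V)}"

text \<open>
  The sheaf of ideals J defines the double structure on X that is given by the line
  bundle L on X and the surjection p from the conormal sheaf to L. In use, X is
  a smooth curve. Sheaves on X are viewed on the projective space, by direct image.
\<close>

definition double_structure ::
  "nat \<Rightarrow> 'k::field point set \<Rightarrow> ('k point, 'k, 'm) module_sheaf
    \<Rightarrow> ('k point set \<Rightarrow> ('k point \<Rightarrow> ('k point, 'k) germ) \<Rightarrow> 'm)
    \<Rightarrow> ('k point, 'k) ideal_sheaf \<Rightarrow> bool" where
  "double_structure n X L p J \<longleftrightarrow>
    (let T = zariski n;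
         I = vanishing_ideal n X;
         I2 = ideal_square n I;
         C = quot_sheaf T I I2
     in line_bundle (subtopology T X) (str_sheaf n) L \<and>
        module_sheaf_hom T (str_sheaf n) C (push_forward X L) p \<and>
        surjective_sheaf_map T C (push_forward X L) p \<and>
        (\<forall>U. openin T U \<longrightarrow>
          J U = {f \<in> I U. p U (quot_proj T I I2 U f) = \<zero>\<^bsub>Sec (push_forward X L) U\<^esub>}))"

definition veronese :: "nat \<Rightarrow> (nat \<Rightarrow> 'k::field) \<Rightarrow> nat \<Rightarrow> 'k" where
  "veronese d v = (\<lambda>i. if i \<le> d then v 0 ^ (d - i) * v 1 ^ i else 0)"

definition rational_normal_curve :: "nat \<Rightarrow> 'k::field point set" where
  "rational_normal_curve d = (\<lambda>v. proj_point (veronese d v)) ` coords 1"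


section \<open>The homogeneous ideal and its resolution\<close>

text \<open>
  The global sections of the twist of J by l, inside the space of forms of degree l. Where a form
  g of degree l has no zeros, it trivialises the twisting sheaf, and f corresponds to f/g.
\<close>

definition twisted_sections ::
  "nat \<Rightarrow> ('k::field point, 'k) ideal_sheaf \<Rightarrow> nat \<Rightarrow> 'k mpoly set" where
  "twisted_sections n J l =
    {f \<in> forms n l. \<forall>U g. openin (zariski n) U \<and> g \<in> forms n l \<and>
       (\<forall>P\<in>U. \<forall>v\<in>P. peval g v \<noteq> 0) \<longrightarrow>
       (\<exists>h\<in>J U. \<forall>P\<in>U. \<forall>v\<in>P. h P = peval f v / peval g v)}"

definition homogeneous_ideal :: "nat \<Rightarrow> ('k::field point, 'k) ideal_sheaf \<Rightarrow> 'k mpoly set" where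
  "homogeneous_ideal n J =
    {\<Sum>l\<in>A. f l | A f. finite A \<and> (\<forall>l\<in>A. f l \<in> twisted_sections n J l)}"

definition free_mod :: "nat \<Rightarrow> nat \<Rightarrow> (nat \<Rightarrow> 'k::field mpoly) set" where
  "free_mod n b = {v. (\<forall>j<b. v j \<in> poly_ring n) \<and> (\<forall>j\<ge>b. v j = 0)}"

definition mat_app ::
  "nat \<Rightarrow> nat \<Rightarrow> (nat \<Rightarrow> nat \<Rightarrow> 'k::field mpoly) \<Rightarrow> (nat \<Rightarrow> 'k mpoly) \<Rightarrow> nat \<Rightarrow> 'k mpoly" where
  "mat_app c b A v = (\<lambda>j. if j < c then (\<Sum>k<b. A j k * v k) else 0)"

text \<open>
  A minimal graded free resolution of a homogeneous ideal J. The module in step i is free on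
  b i generators, of degrees \<open>\<delta> i 0\<close>, \<open>\<delta> i 1\<close> and so on, that is, the direct sum of the
  \<open>R(- \<delta> i j)\<close> for j < b i. The generators in step 0 map to the elements q of J, and A i is the
  matrix of the map from step i + 1 to step i. Minimality says that the entries of A i lie in the
  irrelevant ideal, i.e. have constant term 0.
\<close>

definition minimal_graded_free_resolution ::
  "nat \<Rightarrow> 'k::field mpoly set \<Rightarrow> (nat \<Rightarrow> nat) \<Rightarrow> (nat \<Rightarrow> nat \<Rightarrow> nat)
    \<Rightarrow> (nat \<Rightarrow> 'k mpoly) \<Rightarrow> (nat \<Rightarrow> nat \<Rightarrow> nat \<Rightarrow> 'k mpoly) \<Rightarrow> bool" where
  "minimal_graded_free_resolution n J b \<delta> q A \<longleftrightarrow>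
    (\<forall>k<b 0. q k \<in> forms n (\<delta> 0 k)) \<and>
    (\<forall>i. \<forall>j<b i. \<forall>k<b (Suc i).
       (if \<delta> i j \<le> \<delta> (Suc i) k then A i j k \<in> forms n (\<delta> (Suc i) k - \<delta> i j) else A i j k = 0) \<and>
       Poly_Mapping.lookup (A i j k) 0 = 0) \<and>
    (\<lambda>v. \<Sum>k<b 0. q k * v k) ` free_mod n (b 0) = J \<and>
    mat_app (b 0) (b 1) (A 0) ` free_mod n (b 1) =
      {v \<in> free_mod n (b 0). (\<Sum>k<b 0. q k * v k) = 0} \<and>
    (\<forall>i. mat_app (b (Suc i)) (b (Suc (Suc i))) (A (Suc i)) ` free_mod n (b (Suc (Suc i))) =
       {v \<in> free_mod n (b (Suc i)). mat_app (b i) (b (Suc i)) (A i) v = (\<lambda>_. 0)})"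

definition quadrics_with_linear_syzygies :: "nat \<Rightarrow> 'k::field mpoly set \<Rightarrow> bool" where
  "quadrics_with_linear_syzygies n J \<longleftrightarrow>
    (\<exists>b q A. minimal_graded_free_resolution n J b (\<lambda>i j. i + 2) q A)"

end

theory Submission
  imports Defs
begin

text \<open>
  Let \<open>X\<close> be the curve, \<open>I\<close> its ideal and \<open>J \<supseteq> I\<^sup>2\<close> the ideal of the double structure. Since \<open>J\<close>
  contains the squares of \<open>X\<^sub>r\<^sup>d - X\<^sub>0\<^bsup>d-r\<^esup> X\<^sub>d\<^sup>r\<close>, the ring \<open>R/(J, X\<^sub>0, X\<^sub>d)\<close> has finite length.
  If \<open>J\<close> has a linear resolution by quadrics, this ring vanishes in degree 2. For this one kills
  the variables in the order that ends with the system of parameters \<open>X\<^sub>0, X\<^sub>d\<close> and shows by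
  descending induction on the set \<open>S\<close> of killed variables that the resolution tensored with
  \<open>R/(S)\<close> has no homology above the generating degrees: multiplication by the next variable is
  injective on that part of the homology, and nilpotent because \<open>J\<close> acts on the homology by 0.
  So for \<open>0 < i < d\<close> there is a quadric in \<open>J\<close> congruent to \<open>X\<^sub>1 X\<^sub>i\<close> modulo \<open>(X\<^sub>0, X\<^sub>d)\<close>. As it
  vanishes on the curve, it must be the minor \<open>X\<^sub>1 X\<^sub>i - X\<^sub>0 X\<^bsub>i+1\<^esub>\<close>. These minors generate \<open>I\<close> on the
  chart \<open>X\<^sub>0 \<noteq> 0\<close>, so \<open>p\<close> is zero there. This is impossible because \<open>p\<close> maps onto a line bundle.
\<close>

section \<open>Polynomials\<close>

text \<open>Injectivity of multiplication by \<open>X_r\<close> on homology rests on the connecting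
  map: its kernel modulo \<open>S\<close> comes from homology modulo \<open>insert r S\<close>, one
  step further along the resolution. Linearity makes the degrees fit. If \<open>X_r f = D g\<close>
  modulo \<open>S\<close>, with \<open>f\<close> in degrees at least \<open>deg i\<close>, then the
  constant part of \<open>g\<close> is mapped into degree exactly \<open>deg i\<close>, while all
  else starts one degree higher. Quotient complexes are never formed: homology is expressed by
  representatives and congruences modulo a monomial ideal. The quadric must be the minor because of
  weights. Under \<open>X_i = t^i\<close> the quadratic monomials in \<open>(X_0, X_d)\<close>
  become distinct powers of \<open>t\<close>, so only the zero quadric in that ideal vanishes on the
  curve. Generators of the whole homogeneous ideal of the curve are never determined; it suffices to
  compare germs of \<open>I\<close> and \<open>J\<close> at the point \<open>[1:0:...:0]\<close>.
  For \<open>d = 1\<close> there are no minors, and the coordinates of the chart are already powers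
  of \<open>X_1 / X_0\<close>.\<close>

lemma poly_mapping_eq_sum_single:
  "(f :: 'a \<Rightarrow>\<^sub>0 'b::comm_monoid_add) = (\<Sum>m\<in>Poly_Mapping.keys f. Poly_Mapping.single m (Poly_Mapping.lookup f m))"
  by (rule poly_mapping_eqI)
    (simp add: lookup_sum lookup_single when_def in_keys_iff sum.delta' split: if_splits)

lemma mpoly_induct [case_names zero add]:
  fixes f :: "'a \<Rightarrow>\<^sub>0 'b::comm_monoid_add"
  assumes "P 0" and "\<And>m c g. P g \<Longrightarrow> P (Poly_Mapping.single m c + g)"
  shows "P f"
proof -
  have "P (\<Sum>m\<in>A. Poly_Mapping.single m (Poly_Mapping.lookup f m))" if "finite A" for A
    using that by induction (use assms in auto)
  from this[of "Poly_Mapping.keys f"] show ?thesis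
    by (simp flip: poly_mapping_eq_sum_single)
qed

lemma mon_degree_superset:
  assumes "finite A" "Poly_Mapping.keys m \<subseteq> A"
  shows "mon_degree m = (\<Sum>i\<in>A. Poly_Mapping.lookup m i)"
  unfolding mon_degree_def
  by (rule sum.mono_neutral_left) (use assms in \<open>auto simp: in_keys_iff\<close>)

lemma keys_add_nat: "Poly_Mapping.keys (m + m' :: 'a \<Rightarrow>\<^sub>0 nat) = Poly_Mapping.keys m \<union> Poly_Mapping.keys m'"
  by (auto simp: in_keys_iff lookup_add)

lemma mon_degree_add: "mon_degree (m + m') = mon_degree m + mon_degree m'"
proof -
  let ?A = "Poly_Mapping.keys m \<union> Poly_Mapping.keys m'"
  show ?thesis
    by (subst (1 2 3) mon_degree_superset[of ?A]) (auto simp: keys_add_nat lookup_add sum.distrib)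
qed

lemma mon_degree_single [simp]: "mon_degree (Poly_Mapping.single i e) = e"
  by (subst mon_degree_superset[of "{i}"]) auto

lemma mon_degree_zero [simp]: "mon_degree 0 = 0"
  by (simp add: mon_degree_def)

lemma mon_degree_eq_0_iff: "mon_degree m = 0 \<longleftrightarrow> m = 0"
  unfolding mon_degree_def
  by (metis (no_types, lifting) finite_keys in_keys_iff keys_eq_empty sum_eq_0_iff all_not_in_conv)

definition mon_eval :: "(nat \<Rightarrow>\<^sub>0 nat) \<Rightarrow> (nat \<Rightarrow> 'k::field) \<Rightarrow> 'k" where
  "mon_eval m v = (\<Prod>i\<in>Poly_Mapping.keys m. v i ^ Poly_Mapping.lookup m i)"

lemma mon_eval_superset:
  assumes "finite A" "Poly_Mapping.keys m \<subseteq> A"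
  shows "mon_eval m v = (\<Prod>i\<in>A. v i ^ Poly_Mapping.lookup m i)"
  unfolding mon_eval_def
  by (rule prod.mono_neutral_left) (use assms in \<open>auto simp: in_keys_iff\<close>)

lemma mon_eval_add: "mon_eval (m + m') v = mon_eval m v * mon_eval m' v"
proof -
  let ?A = "Poly_Mapping.keys m \<union> Poly_Mapping.keys m'"
  show ?thesis
    by (subst (1 2 3) mon_eval_superset[of ?A])
      (auto simp: keys_add_nat lookup_add prod.distrib power_add)
qed

lemma mon_eval_zero [simp]: "mon_eval 0 v = 1"
  by (simp add: mon_eval_def)

lemma mon_eval_single [simp]: "mon_eval (Poly_Mapping.single i e) v = v i ^ e"
  by (subst mon_eval_superset[of "{i}"]) auto

lemma mon_eval_scale: "mon_eval m (\<lambda>i. c * v i) = c ^ mon_degree m * mon_eval m v"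
  by (simp add: mon_eval_def mon_degree_def power_mult_distrib prod.distrib power_sum)

lemma peval_alt: "peval f v = (\<Sum>m\<in>Poly_Mapping.keys f. Poly_Mapping.lookup f m * mon_eval m v)"
  by (simp add: peval_def mon_eval_def)

lemma peval_superset:
  assumes "finite A" "Poly_Mapping.keys f \<subseteq> A"
  shows "peval f v = (\<Sum>m\<in>A. Poly_Mapping.lookup f m * mon_eval m v)"
  unfolding peval_alt
  by (rule sum.mono_neutral_left) (use assms in \<open>auto simp: in_keys_iff\<close>)

lemma peval_zero [simp]: "peval 0 v = 0"
  by (simp add: peval_def)

lemma peval_add: "peval (f + g) v = peval f v + peval g v"
proof -
  let ?A = "Poly_Mapping.keys f \<union> Poly_Mapping.keys g"
  have "Poly_Mapping.keys (f + g) \<subseteq> ?A" by (rule Poly_Mapping.keys_add)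
  then show ?thesis
    by (subst (1 2 3) peval_superset[of ?A]) (auto simp: lookup_add sum.distrib algebra_simps)
qed

lemma peval_single [simp]: "peval (Poly_Mapping.single m c) v = c * mon_eval m v"
  by (subst peval_superset[of "{m}"]) auto

lemma peval_one [simp]: "peval 1 v = 1"
  by (simp flip: single_one)

lemma peval_mult_single: "peval (Poly_Mapping.single m c * g) v = c * mon_eval m v * peval g v"
  by (induction g rule: mpoly_induct)
    (simp_all add: distrib_left peval_add mult_single mon_eval_add algebra_simps)

lemma peval_mult: "peval (f * g) v = peval f v * peval g v"
  by (induction f rule: mpoly_induct)
    (simp_all add: distrib_right peval_add peval_mult_single)

lemma peval_uminus: "peval (- f) v = - peval f v"
  by (metis add.right_inverse peval_add peval_zero minus_unique)

lemma peval_diff: "peval (f - g) v = peval f v - peval g v"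
  using peval_add[of f "- g" v] by (simp add: peval_uminus)

lemma peval_power: "peval (f ^ e) v = peval f v ^ e"
  by (induction e) (simp_all add: peval_mult)

definition var :: "nat \<Rightarrow> 'k::field mpoly" where
  "var i = Poly_Mapping.single (Poly_Mapping.single i 1) 1"

lemma peval_var [simp]: "peval (var i) v = v i"
  by (simp add: var_def)

lemma in_keys_multE:
  assumes "m \<in> Poly_Mapping.keys (f * g)"
  obtains a b where "m = a + b" "a \<in> Poly_Mapping.keys f" "b \<in> Poly_Mapping.keys g"
  using assms keys_mult[of f g] by blast

lemma keys_diff_general: "Poly_Mapping.keys (f - g :: 'a \<Rightarrow>\<^sub>0 'b::ab_group_add) \<subseteq> Poly_Mapping.keys f \<union> Poly_Mapping.keys g"
  by (auto simp: in_keys_iff lookup_minus)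

lemma keys_sum_general: "Poly_Mapping.keys (sum f A :: 'a \<Rightarrow>\<^sub>0 'b::comm_monoid_add) \<subseteq> (\<Union>i\<in>A. Poly_Mapping.keys (f i))"
proof (induction A rule: infinite_finite_induct)
  case (insert x A)
  then show ?case using Poly_Mapping.keys_add[of "f x" "sum f A"] by auto
qed auto

lemma poly_ring_zero [simp]: "0 \<in> poly_ring n"
  and poly_ring_one [simp]: "1 \<in> poly_ring n"
  and poly_ring_add: "f \<in> poly_ring n \<Longrightarrow> g \<in> poly_ring n \<Longrightarrow> f + g \<in> poly_ring n"
  and poly_ring_diff: "f \<in> poly_ring n \<Longrightarrow> g \<in> poly_ring n \<Longrightarrow> f - g \<in> poly_ring n"
  unfolding poly_ring_def using Poly_Mapping.keys_add[of f g] keys_diff_general[of f g] by fastforce+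

lemma poly_ring_mult: "f \<in> poly_ring n \<Longrightarrow> g \<in> poly_ring n \<Longrightarrow> f * g \<in> poly_ring n"
  unfolding poly_ring_def by (fastforce elim!: in_keys_multE simp: keys_add_nat)

lemma poly_ring_sum: "(\<And>i. i \<in> A \<Longrightarrow> f i \<in> poly_ring n) \<Longrightarrow> sum f A \<in> poly_ring n"
  by (induction A rule: infinite_finite_induct) (auto intro: poly_ring_add)

lemma poly_ring_power: "f \<in> poly_ring n \<Longrightarrow> f ^ e \<in> poly_ring n"
  by (induction e) (auto intro: poly_ring_mult)

lemma var_in_poly_ring [simp]: "var i \<in> poly_ring n \<longleftrightarrow> i \<le> n"
  by (auto simp: poly_ring_def var_def)

lemma forms_zero [simp]: "0 \<in> forms n l"
  by (simp add: forms_def)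

lemma forms_poly_ring: "f \<in> forms n l \<Longrightarrow> f \<in> poly_ring n"
  by (simp add: forms_def)

lemma forms_add: "f \<in> forms n l \<Longrightarrow> g \<in> forms n l \<Longrightarrow> f + g \<in> forms n l"
  using Poly_Mapping.keys_add[of f g] by (fastforce simp: forms_def poly_ring_add)

lemma forms_diff: "f \<in> forms n l \<Longrightarrow> g \<in> forms n l \<Longrightarrow> f - g \<in> forms n l"
  using keys_diff_general[of f g] by (fastforce simp: forms_def poly_ring_diff)

lemma forms_mult: "f \<in> forms n l \<Longrightarrow> g \<in> forms n l' \<Longrightarrow> f * g \<in> forms n (l + l')"
  by (auto simp: forms_def poly_ring_mult mon_degree_add elim!: in_keys_multE)

lemma forms_sum: "(\<And>i. i \<in> A \<Longrightarrow> f i \<in> forms n l) \<Longrightarrow> sum f A \<in> forms n l"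
  by (induction A rule: infinite_finite_induct) (auto intro: forms_add)

lemma forms_one [simp]: "1 \<in> forms n 0"
  by (simp add: forms_def)

lemma forms_power: "f \<in> forms n l \<Longrightarrow> f ^ e \<in> forms n (e * l)"
  by (induction e) (auto intro: forms_mult)

lemma forms_var [simp]: "i \<le> n \<Longrightarrow> var i \<in> forms n 1"
  by (auto simp: forms_def) (auto simp: var_def)

lemma peval_scale: "f \<in> forms n l \<Longrightarrow> peval f (\<lambda>i. c * v i) = c ^ l * peval f v"
  by (auto simp: peval_alt forms_def mon_eval_scale sum_distrib_left algebra_simps intro!: sum.cong)

section \<open>Ideals generated by variables\<close>

text \<open>The ideal generated by the variables with index in \<open>S\<close>, described through
  supports. Membership is a condition on each monomial separately, so congruences can be tested
  coefficient by coefficient.\<close>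

definition var_ideal :: "nat set \<Rightarrow> 'k::field mpoly set" where
  "var_ideal S = {f. \<forall>m\<in>Poly_Mapping.keys f. Poly_Mapping.keys m \<inter> S \<noteq> {}}"

lemma var_ideal_zero [simp]: "0 \<in> var_ideal S"
  by (simp add: var_ideal_def)

lemma var_ideal_add: "f \<in> var_ideal S \<Longrightarrow> g \<in> var_ideal S \<Longrightarrow> f + g \<in> var_ideal S"
  using Poly_Mapping.keys_add[of f g] by (auto simp: var_ideal_def)

lemma var_ideal_diff: "f \<in> var_ideal S \<Longrightarrow> g \<in> var_ideal S \<Longrightarrow> f - g \<in> var_ideal S"
  using keys_diff_general[of f g] by (auto simp: var_ideal_def)

lemma var_ideal_sum: "(\<And>i. i \<in> A \<Longrightarrow> f i \<in> var_ideal S) \<Longrightarrow> sum f A \<in> var_ideal S"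
  by (induction A rule: infinite_finite_induct) (auto intro: var_ideal_add)

lemma var_ideal_mult: "f \<in> var_ideal S \<Longrightarrow> g * f \<in> var_ideal S"
  by (fastforce simp: var_ideal_def keys_add_nat elim!: in_keys_multE)

lemma var_ideal_mono: "f \<in> var_ideal S \<Longrightarrow> S \<subseteq> T \<Longrightarrow> f \<in> var_ideal T"
  by (auto simp: var_ideal_def)

lemma var_mem_var_ideal: "i \<in> S \<Longrightarrow> var i \<in> var_ideal S"
  by (auto simp: var_ideal_def var_def)

lemma lookup_var_mult: "Poly_Mapping.lookup (var i * f) (Poly_Mapping.single i 1 + m) = Poly_Mapping.lookup f m"
proof (induction f rule: mpoly_induct)
  case (add a c g)
  have "Poly_Mapping.lookup (Poly_Mapping.single (Poly_Mapping.single i (Suc 0) + a) c) (Poly_Mapping.single i (Suc 0) + m)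
      = Poly_Mapping.lookup (Poly_Mapping.single a c) m"
    by (auto simp: lookup_single when_def)
  then show ?case using add by (simp add: distrib_left lookup_add var_def mult_single)
qed simp

text \<open>\<open>X_r\<close> is a nonzerodivisor modulo the other variables: multiplication by it
  adds only \<open>r\<close> to the support of a monomial, so a monomial that avoids
  \<open>S\<close> continues to avoid it.\<close>

lemma var_mult_var_ideal_cancel:
  assumes "r \<notin> S" "var r * f \<in> var_ideal S"
  shows "f \<in> var_ideal S"
  unfolding var_ideal_def
proof safe
  fix m assume m: "m \<in> Poly_Mapping.keys f" and "Poly_Mapping.keys m \<inter> S = {}"
  moreover have "Poly_Mapping.single r 1 + m \<in> Poly_Mapping.keys (var r * f)"
    using m unfolding in_keys_iff lookup_var_mult .
  ultimately show False using assms by (force simp: var_ideal_def keys_add_nat)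
qed

text \<open>Sort the monomials of \<open>f\<close>: those that avoid \<open>S\<close> must contain
  \<open>X_r\<close> and are divided by it, the others make up \<open>h\<close>.\<close>

lemma var_ideal_insertE:
  assumes "f \<in> var_ideal (insert r S)" "f \<in> poly_ring n"
  obtains g h where "g \<in> poly_ring n" "h \<in> var_ideal S" "f = var r * g + h"
proof -
  let ?A = "{m\<in>Poly_Mapping.keys f. Poly_Mapping.keys m \<inter> S = {}}"
  let ?B = "Poly_Mapping.keys f - ?A"
  let ?s = "\<lambda>m. Poly_Mapping.single m (Poly_Mapping.lookup f m)"
  let ?q = "\<lambda>m. Poly_Mapping.single (m - Poly_Mapping.single r 1) (Poly_Mapping.lookup f m)"
  \<comment> \<open>Subtraction of exponents is truncated; it undoes the addition here because
    \<open>r\<close> occurs in \<open>m\<close>.\<close>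
  have 1: "?s m = var r * ?q m" if "m \<in> ?A" for m
  proof -
    have "r \<in> Poly_Mapping.keys m" using that assms(1) by (auto simp: var_ideal_def)
    then have "Poly_Mapping.single r 1 + (m - Poly_Mapping.single r 1) = m"
      by (intro poly_mapping_eqI) (auto simp: lookup_add lookup_minus lookup_single when_def in_keys_iff)
    then show ?thesis by (simp add: var_def mult_single)
  qed
  have "f = sum ?s ?A + sum ?s ?B"
    by (subst poly_mapping_eq_sum_single[of f], subst sum.union_disjoint[symmetric])
      (auto intro!: sum.cong)
  also have "sum ?s ?A = var r * sum ?q ?A"
    by (simp add: sum_distrib_left 1)
  finally have "f = var r * sum ?q ?A + sum ?s ?B" .
  moreover have "sum ?q ?A \<in> poly_ring n"
  proof (rule poly_ring_sum)
    fix m assume "m \<in> ?A"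
    then have "Poly_Mapping.keys m \<subseteq> {..n}" using assms(2) by (auto simp: poly_ring_def)
    moreover have "Poly_Mapping.keys (m - Poly_Mapping.single r 1) \<subseteq> Poly_Mapping.keys m"
      by (auto simp: in_keys_iff lookup_minus)
    ultimately show "?q m \<in> poly_ring n" by (auto simp: poly_ring_def)
  qed
  moreover have "sum ?s ?B \<in> var_ideal S"
    by (rule var_ideal_sum) (auto simp: var_ideal_def)
  ultimately show thesis using that by blast
qed

section \<open>Linear resolutions\<close>

lemma free_mod_poly_ring: "v \<in> free_mod n b \<Longrightarrow> v j \<in> poly_ring n"
  by (cases "j < b") (auto simp: free_mod_def)

lemma free_mod_diff: "v \<in> free_mod n b \<Longrightarrow> w \<in> free_mod n b \<Longrightarrow> (\<lambda>j. v j - w j) \<in> free_mod n b"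
  and free_mod_mult: "a \<in> poly_ring n \<Longrightarrow> v \<in> free_mod n b \<Longrightarrow> (\<lambda>j. a * v j) \<in> free_mod n b"
  by (auto simp: free_mod_def poly_ring_diff poly_ring_mult)

lemma mat_app_add: "mat_app c b A (\<lambda>k. v k + w k) j = mat_app c b A v j + mat_app c b A w j"
  by (simp add: mat_app_def distrib_left sum.distrib)

lemma mat_app_diff: "mat_app c b A (\<lambda>k. v k - w k) j = mat_app c b A v j - mat_app c b A w j"
  by (simp add: mat_app_def right_diff_distrib sum_subtractf)

lemma mat_app_mult: "mat_app c b A (\<lambda>k. a * v k) j = a * mat_app c b A v j"
  by (simp add: mat_app_def sum_distrib_left mult.left_commute)

lemma mat_app_zero [simp]: "mat_app c b A (\<lambda>k. 0) j = 0"
  by (simp add: mat_app_def)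

lemma mat_app_sum: "mat_app c b A (\<lambda>k. \<Sum>i\<in>K. a i * w i k) j = (\<Sum>i\<in>K. a i * mat_app c b A (w i) j)"
  by (induction K rule: infinite_finite_induct) (simp_all add: mat_app_add mat_app_mult)

lemma mat_app_var_ideal: "(\<And>k. v k \<in> var_ideal S) \<Longrightarrow> mat_app c b A v j \<in> var_ideal S"
  by (auto simp: mat_app_def intro!: var_ideal_sum var_ideal_mult)

lemma mat_app_free_mod:
  assumes "\<And>j k. j < c \<Longrightarrow> k < b \<Longrightarrow> A j k \<in> poly_ring n" "v \<in> free_mod n b"
  shows "mat_app c b A v \<in> free_mod n c"
  using assms by (auto simp: free_mod_def mat_app_def intro!: poly_ring_sum poly_ring_mult)

locale linear_quadric_resolution =
  fixes n :: nat and J :: "'k::field mpoly set" and b q A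
  assumes resolution: "minimal_graded_free_resolution n J b (\<lambda>i j. i + 2) q A"
begin

text \<open>
  The augmented resolution is indexed so that \<open>E 0\<close> is the ring and \<open>E (i + 1)\<close> the module in
  step \<open>i\<close>; \<open>D i\<close> maps \<open>E (i + 1)\<close> to \<open>E i\<close> and has entries of degree \<open>deg i\<close>.
\<close>

definition rank :: "nat \<Rightarrow> nat" where
  "rank i = (case i of 0 \<Rightarrow> 1 | Suc i' \<Rightarrow> b i')"

definition mat :: "nat \<Rightarrow> nat \<Rightarrow> nat \<Rightarrow> 'k mpoly" where
  "mat i = (case i of 0 \<Rightarrow> (\<lambda>j k. q k) | Suc i' \<Rightarrow> A i')"

definition D :: "nat \<Rightarrow> (nat \<Rightarrow> 'k mpoly) \<Rightarrow> nat \<Rightarrow> 'k mpoly" where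
  "D i = mat_app (rank i) (rank (Suc i)) (mat i)"

abbreviation E :: "nat \<Rightarrow> (nat \<Rightarrow> 'k mpoly) set" where
  "E i \<equiv> free_mod n (rank i)"

definition deg :: "nat \<Rightarrow> nat" where
  "deg i = (if i = 0 then 2 else 1)"

text \<open>The generator degrees \<open>i + 2\<close> enter the argument here: they make the
  \<open>q k\<close> quadrics and the entries of every later matrix linear.\<close>

lemma mat_forms:
  assumes "j < rank i" "k < rank (Suc i)"
  shows "mat i j k \<in> forms n (deg i)"
proof (cases i)
  case 0
  then show ?thesis using assms resolution
    by (simp add: minimal_graded_free_resolution_def rank_def mat_def deg_def numeral_2_eq_2)
next
  case (Suc i')
  have *: "\<forall>i. \<forall>j<b i. \<forall>k<b (Suc i). (if i + 2 \<le> Suc i + 2 then A i j k \<in> forms n (Suc i + 2 - (i + 2)) else A i j k = 0)"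
    using resolution unfolding minimal_graded_free_resolution_def by blast
  have "A i' j k \<in> forms n 1"
    using *[rule_format, of j i' k] assms Suc by (simp add: rank_def)
  then show ?thesis using Suc by (simp add: mat_def deg_def)
qed

lemma D_closed: "v \<in> E (Suc i) \<Longrightarrow> D i v \<in> E i"
  unfolding D_def by (rule mat_app_free_mod) (auto intro: forms_poly_ring[OF mat_forms])

lemma D_diff: "D i (\<lambda>k. v k - w k) j = D i v j - D i w j"
  and D_mult: "D i (\<lambda>k. a * v k) j = a * D i v j"
  and D_sum: "D i (\<lambda>k. \<Sum>l\<in>K. c l * u l k) j = (\<Sum>l\<in>K. c l * D i (u l) j)"
  and D_var_ideal: "(\<And>k. v k \<in> var_ideal S) \<Longrightarrow> D i v j \<in> var_ideal S"
  by (simp_all add: D_def mat_app_diff mat_app_mult mat_app_sum mat_app_var_ideal)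

lemma D_0: "D 0 v 0 = (\<Sum>k<b 0. q k * v k)"
  by (simp add: D_def mat_app_def rank_def mat_def)

lemma E_0: "v \<in> E 0 \<Longrightarrow> j > 0 \<Longrightarrow> v j = 0"
  by (simp add: free_mod_def rank_def)

text \<open>With the augmentation counted as \<open>D 0\<close>, exactness at step 0 and at the
  later steps becomes one formula.\<close>

lemma exact: "D (Suc i) ` E (Suc (Suc i)) = {v \<in> E (Suc i). D i v = (\<lambda>_. 0)}"
proof (cases i)
  case 0
  have "D 0 v = (\<lambda>_. 0) \<longleftrightarrow> (\<Sum>k<b 0. q k * v k) = 0" for v
    by (auto simp: D_def mat_app_def rank_def mat_def fun_eq_iff)
  then show ?thesis using resolution 0
    by (simp add: minimal_graded_free_resolution_def D_def mat_def rank_def)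
next
  case (Suc i')
  then show ?thesis using resolution
    by (simp add: minimal_graded_free_resolution_def D_def mat_def rank_def)
qed

lemma mem_ideal_iff: "f \<in> J \<longleftrightarrow> (\<exists>v\<in>E 1. f = D 0 v 0)"
proof -
  have "J = (\<lambda>v. \<Sum>k<b 0. q k * v k) ` free_mod n (b 0)"
    using resolution by (simp add: minimal_graded_free_resolution_def)
  then show ?thesis unfolding D_0 by (simp add: image_iff rank_def)
qed

lemma ideal_poly_ring: "f \<in> J \<Longrightarrow> f \<in> poly_ring n"
  using free_mod_poly_ring[OF D_closed] unfolding mem_ideal_iff by auto

section \<open>Homology of the resolution modulo a set of variables\<close>

definition boundary_mod :: "nat set \<Rightarrow> nat \<Rightarrow> (nat \<Rightarrow> 'k mpoly) \<Rightarrow> bool" where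
  "boundary_mod S i f \<longleftrightarrow> (\<exists>g\<in>E (Suc i). \<forall>j. f j - D i g j \<in> var_ideal S)"

text \<open>A lower bound on all monomials replaces homogeneity, which spares splitting vectors into
  graded pieces.\<close>

definition order_ge :: "nat \<Rightarrow> (nat \<Rightarrow> 'k mpoly) \<Rightarrow> bool" where
  "order_ge e f \<longleftrightarrow> (\<forall>j. \<forall>m\<in>Poly_Mapping.keys (f j). e \<le> mon_degree m)"

text \<open>Degrees are relative to the generators of \<open>E i\<close>. For \<open>i = 0\<close>
  the cycle condition is empty and the claim is that \<open>R/(J, S)\<close> vanishes in degrees at
  least 2. For positive \<open>i\<close> it says that cycles modulo \<open>S\<close> without
  constant terms are boundaries modulo \<open>S\<close>.\<close>

definition acyclic_above :: "nat set \<Rightarrow> bool" where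
  "acyclic_above S \<longleftrightarrow>
    (\<forall>i f. f \<in> E i \<and> order_ge (deg i) f \<and> (\<forall>i' j. i = Suc i' \<longrightarrow> D i' f j \<in> var_ideal S) \<longrightarrow> boundary_mod S i f)"

text \<open>A preimage \<open>g\<close> of \<open>X_r f\<close> modulo \<open>S\<close> is a cycle
  modulo \<open>insert r S\<close>. Without its constant part it is a boundary there, and dividing
  what is left by \<open>X_r\<close> yields a preimage of \<open>f\<close>.\<close>

lemma boundary_mod_step:
  assumes ac: "acyclic_above (insert r S)" and r: "r \<notin> S" 
    and f: "f \<in> E i" "order_ge (deg i) f" and hit: "boundary_mod S i (\<lambda>j. var r * f j)"
  shows "boundary_mod S i f"
proof -
  obtain g where g: "g \<in> E (Suc i)" and fg: "\<And>j. var r * f j - D i g j \<in> var_ideal S"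
    using hit by (auto simp: boundary_mod_def)
  \<comment> \<open>Since \<open>deg (Suc i) = 1\<close>, acyclicity covers only vectors without
    constant terms; hence the splitting into constants \<open>g0\<close> and the rest
    \<open>g1\<close>.\<close>
  define g0 where "g0 = (\<lambda>j. Poly_Mapping.single (0::nat \<Rightarrow>\<^sub>0 nat) (Poly_Mapping.lookup (g j) 0))"
  define g1 where "g1 = (\<lambda>j. g j - g0 j)"
  have g0_forms: "g0 j \<in> forms n 0" for j
    by (auto simp: g0_def forms_def poly_ring_def)
  have g0: "g0 \<in> E (Suc i)"
    using g g0_forms by (auto simp: free_mod_def forms_def) (simp add: g0_def)
  have g1: "g1 \<in> E (Suc i)"
    unfolding g1_def by (rule free_mod_diff[OF g g0])
  have g1_deg: "mon_degree m \<ge> 1" if "m \<in> Poly_Mapping.keys (g1 j)" for m j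
  proof -
    have "m \<noteq> 0" using that by (auto simp: g1_def g0_def in_keys_iff lookup_minus)
    then show ?thesis using mon_degree_eq_0_iff[of m] by linarith
  qed
  have D_g: "D i g j = D i g0 j + D i g1 j" for j
    by (simp add: g1_def D_diff)
  \<comment> \<open>Compare degrees: \<open>D i g0\<close> lives in degree \<open>deg i\<close>,
    while \<open>D i g1\<close> and \<open>X_r f\<close> start one degree higher. Every monomial of
    \<open>D i g0\<close> therefore survives in \<open>X_r f - D i g\<close>, whose monomials all
    meet \<open>S\<close>.\<close>
  have D_g0: "D i g0 j \<in> var_ideal S" for j
    unfolding var_ideal_def
  proof safe
    fix m assume m: "m \<in> Poly_Mapping.keys (D i g0 j)" and disj: "Poly_Mapping.keys m \<inter> S = {}"
    have "D i g0 j \<in> forms n (deg i)"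
    proof (cases "j < rank i")
      case True
      then show ?thesis
        using forms_mult[OF mat_forms g0_forms]
        by (auto simp: D_def mat_app_def intro!: forms_sum)
    qed (simp add: D_def mat_app_def)
    then have deg_m: "mon_degree m = deg i" using m by (auto simp: forms_def)
    have "m \<notin> Poly_Mapping.keys (D i g1 j)"
    proof
      assume "m \<in> Poly_Mapping.keys (D i g1 j)"
      then obtain k where "j < rank i" "k < rank (Suc i)" "m \<in> Poly_Mapping.keys (mat i j k * g1 k)"
        using keys_sum_general[of "\<lambda>k. mat i j k * g1 k" "{..<rank (Suc i)}"]
        by (auto simp: D_def mat_app_def split: if_splits)
      then show False
        using mat_forms[of j i k] g1_deg[of _ k] deg_m
        by (fastforce elim!: in_keys_multE simp: mon_degree_add forms_def)
    qed
    moreover have "m \<notin> Poly_Mapping.keys (var r * f j)"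
    proof
      assume "m \<in> Poly_Mapping.keys (var r * f j)"
      then obtain a where "a \<in> Poly_Mapping.keys (f j)" "mon_degree m = 1 + mon_degree a"
        by (auto simp: mon_degree_add var_def elim!: in_keys_multE)
      then show False using f(2) deg_m by (fastforce simp: order_ge_def)
    qed
    ultimately have "m \<in> Poly_Mapping.keys (var r * f j - D i g j)"
      using m by (simp add: in_keys_iff lookup_minus D_g lookup_add)
    then show False using fg[of j] disj by (auto simp: var_ideal_def)
  qed
  have D_g1: "D i g1 j = var r * f j - (var r * f j - D i g j) - D i g0 j" for j
    by (simp add: D_g)
  note sub = var_ideal_mono[OF _ subset_insertI, of _ S r]
  have "D i g1 j \<in> var_ideal (insert r S)" for j
    unfolding D_g1
    by (intro var_ideal_diff sub[OF fg] sub[OF D_g0])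
      (metis insertI1 mult.commute var_ideal_mult var_mem_var_ideal)
  moreover have "order_ge (deg (Suc i)) g1"
    using g1_deg by (auto simp: order_ge_def deg_def)
  ultimately have "boundary_mod (insert r S) (Suc i) g1"
    using ac g1 by (auto simp: acyclic_above_def)
  then obtain h where h: "h \<in> E (Suc (Suc i))"
    and g1h: "\<And>j. g1 j - D (Suc i) h j \<in> var_ideal (insert r S)"
    by (auto simp: boundary_mod_def)
  let ?u = "\<lambda>j. g1 j - D (Suc i) h j"
  have u: "?u \<in> E (Suc i)"
    by (rule free_mod_diff[OF g1 D_closed[OF h]])
  \<comment> \<open>The remainder of \<open>g1\<close> after subtracting a boundary is
    \<open>X_r g2\<close> modulo \<open>S\<close>; the value 0 beyond the rank puts
    \<open>g2\<close> into \<open>E (Suc i)\<close>.\<close>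
  have "\<exists>g2. g2 \<in> poly_ring n \<and> ?u j - var r * g2 \<in> var_ideal S \<and> (j \<ge> rank (Suc i) \<longrightarrow> g2 = 0)" for j
  proof (cases "j < rank (Suc i)")
    case True
    then show ?thesis
      using var_ideal_insertE[OF g1h free_mod_poly_ring[OF u], of j] by (metis add_diff_cancel_left' not_le)
  next
    case False
    then have "?u j = 0" using u by (simp add: free_mod_def)
    then show ?thesis by (intro exI[of _ 0]) auto
  qed
  then obtain g2 where g2: "\<And>j. g2 j \<in> poly_ring n" "\<And>j. ?u j - var r * g2 j \<in> var_ideal S"
      "\<And>j. j \<ge> rank (Suc i) \<Longrightarrow> g2 j = 0"
    by metis
  have DD: "D i (D (Suc i) h) j = 0" for j
    using exact[of i] h by (auto simp: fun_eq_iff)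
  \<comment> \<open>Applying \<open>D i\<close> removes the boundary, so \<open>X_r f\<close> and
    \<open>X_r D i g2\<close> agree modulo \<open>S\<close>, and \<open>X_r\<close> can be
    cancelled.\<close>
  have "D i g1 j = D i (\<lambda>j. ?u j - var r * g2 j) j + var r * D i g2 j" for j
    by (simp add: D_diff D_mult DD)
  then have "var r * (f j - D i g2 j)
      = (var r * f j - D i g j) + D i g0 j + D i (\<lambda>j. ?u j - var r * g2 j) j" for j
    using D_g1[of j] by (simp add: algebra_simps)
  also have "\<dots> j \<in> var_ideal S" for j
    by (intro var_ideal_add fg D_g0 D_var_ideal g2)
  finally have "f j - D i g2 j \<in> var_ideal S" for j
    using var_mult_var_ideal_cancel[OF r] by blast
  moreover have "g2 \<in> E (Suc i)"
    using g2 by (auto simp: free_mod_def)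
  ultimately show ?thesis by (auto simp: boundary_mod_def)
qed

text \<open>Multiplication by powers of \<open>X_r\<close> preserves the order bound, so the factors
  can be cancelled one at a time.\<close>

lemma boundary_mod_power:
  assumes ac: "acyclic_above (insert r S)" and r: "r \<notin> S" "r \<le> n"
    and f: "f \<in> E i" "order_ge (deg i) f" and hit: "boundary_mod S i (\<lambda>j. var r ^ N * f j)"
  shows "boundary_mod S i f"
  using hit
proof (induction N)
  case (Suc N)
  have E: "(\<lambda>j. var r ^ N * f j) \<in> E i"
    using r f by (intro free_mod_mult poly_ring_power) auto
  have order:  "order_ge (deg i) (\<lambda>j. var r ^ N * f j)"
    unfolding order_ge_def
  proof (intro allI ballI)
    fix j m assume "m \<in> Poly_Mapping.keys (var r ^ N * f j)"
    then obtain a c where "m = a + c" "c \<in> Poly_Mapping.keys (f j)" by (rule in_keys_multE)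
    then show "deg i \<le> mon_degree m" using f(2) by (simp add: order_ge_def mon_degree_add trans_le_add2)
  qed
  have "boundary_mod S i (\<lambda>j. var r ^ N * f j)"
    by (rule boundary_mod_step[OF ac r(1) E order]) (use Suc.prems in \<open>simp only: power_Suc mult.assoc\<close>)
  then show ?case by (rule Suc.IH)
qed simp

text \<open>Multiplication by an element of \<open>J\<close> is null-homotopic on the resolution; \<open>h\<close> is the homotopy.\<close>

lemma homotopy:
  assumes "g \<in> J"
  shows "\<exists>h. (\<forall>j k. h j k \<in> poly_ring n) \<and>
    (\<forall>v\<in>E (Suc i). \<forall>j. D i (\<lambda>k. g * v k - mat_app (rank (Suc i)) (rank i) h (D i v) k) j = 0)"
proof (induction i)
  case 0
  \<comment> \<open>At the bottom the homotopy sends 1 to a preimage \<open>c\<close> of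
    \<open>g\<close>.\<close>
  obtain c where c: "c \<in> E 1" "g = D 0 c 0" using assms by (auto simp: mem_ideal_iff)
  have "D 0 (\<lambda>k. g * v k - mat_app (rank (Suc 0)) (rank 0) (\<lambda>j k. c j) (D 0 v) k) j = 0" for v j
  proof -
    have "mat_app (rank (Suc 0)) (rank 0) (\<lambda>j k. c j) (D 0 v) = (\<lambda>k. D 0 v 0 * c k)"
      using c(1) by (auto simp: mat_app_def rank_def free_mod_def fun_eq_iff)
    moreover have "D 0 u j = (if j = 0 then D 0 u 0 else 0)" for u
      by (simp add: D_def mat_app_def rank_def)
    ultimately show ?thesis using c(2) by (cases "j = 0") (simp_all add: D_diff D_mult)
  qed
  then show ?case using free_mod_poly_ring[OF c(1)] by (intro exI[of _ "\<lambda>j k. c j"]) simp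
next
  case (Suc i)
  then obtain h where h: "\<And>j k. h j k \<in> poly_ring n"
    and hom: "\<And>v j. v \<in> E (Suc i) \<Longrightarrow>
      D i (\<lambda>k. g * v k - mat_app (rank (Suc i)) (rank i) h (D i v) k) j = 0"
    by blast
  \<comment> \<open>By the induction hypothesis \<open>H = g - h D\<close> takes values in cycles,
    so it lifts through the next differential. Lifts of the images of the unit vectors
    \<open>e k\<close> are the columns of the next homotopy \<open>h'\<close>.\<close>
  define H where "H = (\<lambda>v k. g * v k - mat_app (rank (Suc i)) (rank i) h (D i v) k)"
  have g: "g \<in> poly_ring n" by (rule ideal_poly_ring[OF assms(1)])
  have H: "H v \<in> E (Suc i)" if "v \<in> E (Suc i)" for v
    unfolding H_def using that h
    by (intro free_mod_diff free_mod_mult mat_app_free_mod D_closed g) auto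
  define e where "e = (\<lambda>(k::nat) j. if j = k then 1 else 0 :: 'k mpoly)"
  have "\<exists>c\<in>E (Suc (Suc i)). k < rank (Suc i) \<longrightarrow> D (Suc i) c = H (e k)" for k
  proof (cases "k < rank (Suc i)")
    case True
    then have e: "e k \<in> E (Suc i)" by (auto simp: e_def free_mod_def)
    with H[OF e] hom[OF e] have "H (e k) \<in> D (Suc i) ` E (Suc (Suc i))"
      unfolding exact by (auto simp: H_def fun_eq_iff)
    then obtain w where w: "w \<in> E (Suc (Suc i))" and "H (e k) = D (Suc i) w" by (rule imageE)
    then have "D (Suc i) w = H (e k)" by (rule_tac sym)
    with w show ?thesis by blast
  next
    case False
    have "(\<lambda>_. 0) \<in> E (Suc (Suc i))" by (simp add: free_mod_def)
    then show ?thesis using False by blast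
  qed
  then obtain c where c: "\<And>k. c k \<in> E (Suc (Suc i))"
    and Dc: "\<And>k. k < rank (Suc i) \<Longrightarrow> D (Suc i) (c k) = H (e k)"
    by metis
  define h' where "h' = (\<lambda>j k. c k j)"
  let ?h' = "mat_app (rank (Suc (Suc i))) (rank (Suc i)) h'"
  have D_h': "D (Suc i) (?h' v) j = H v j" if v: "v \<in> E (Suc i)" for v j
  proof -
    have "?h' v = (\<lambda>j. \<Sum>k<rank (Suc i). v k * c k j)"
      using c by (auto simp: mat_app_def h'_def free_mod_def fun_eq_iff mult.commute)
    then have "D (Suc i) (?h' v) j = (\<Sum>k<rank (Suc i). v k * H (e k) j)"
      by (simp add: D_sum Dc)
    moreover have v_eq: "v = (\<lambda>j. \<Sum>k<rank (Suc i). v k * e k j)"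
    proof
      fix j
      have "(\<Sum>k<rank (Suc i). v k * e k j) = (\<Sum>k<rank (Suc i). if k = j then v k else 0)"
        by (intro sum.cong) (auto simp: e_def)
      then show "v j = (\<Sum>k<rank (Suc i). v k * e k j)"
        using v by (auto simp: free_mod_def)
    qed
    have "D i v = (\<lambda>j. \<Sum>k<rank (Suc i). v k * D i (e k) j)"
      by (subst v_eq) (simp add: D_sum fun_eq_iff)
    then have "H v j = g * (\<Sum>k<rank (Suc i). v k * e k j)
        - (\<Sum>k<rank (Suc i). v k * mat_app (rank (Suc i)) (rank i) h (D i (e k)) j)"
      unfolding H_def by (subst (1) v_eq) (simp add: mat_app_sum)
    ultimately show ?thesis
      by (simp add: H_def right_diff_distrib sum_subtractf sum_distrib_left mult.left_commute)
  qed
  have "D (Suc i) (\<lambda>k. g * v k - ?h' (D (Suc i) v) k) j = 0" if v: "v \<in> E (Suc (Suc i))" for v j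
  proof -
    have "D i (D (Suc i) v) = (\<lambda>_. 0)" using exact[of i] v by auto
    then have "H (D (Suc i) v) j = g * D (Suc i) v j" by (simp add: H_def)
    then show ?thesis by (simp add: D_diff D_mult D_h'[OF D_closed[OF v]])
  qed
  moreover have "h' j k \<in> poly_ring n" for j k
    unfolding h'_def by (rule free_mod_poly_ring[OF c])
  ultimately show ?case by blast
qed

text \<open>With the homotopy \<open>h\<close>, the vector \<open>g f - h (D f)\<close> is a genuine
  cycle, hence a boundary, and \<open>h (D f)\<close> is 0 modulo \<open>S\<close> because
  \<open>f\<close> is a cycle modulo \<open>S\<close>. For \<open>i = 0\<close> a preimage of
  \<open>g\<close> is multiplied by \<open>f 0\<close>.\<close>

lemma boundary_mod_mult_ideal:
  assumes "g \<in> J" and f: "f \<in> E i" "\<And>i' j. i = Suc i' \<Longrightarrow> D i' f j \<in> var_ideal S"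
  shows "boundary_mod S i (\<lambda>j. g * f j)"
proof (cases i)
  case 0
  obtain c where c: "c \<in> E 1" "g = D 0 c 0" using assms(1) by (auto simp: mem_ideal_iff)
  have "g * f j = D 0 (\<lambda>k. f 0 * c k) j" for j
  proof (cases "j = 0")
    case False
    then have "f j = 0" using f(1) 0 by (simp add: E_0)
    moreover have "D 0 (\<lambda>k. f 0 * c k) j = 0" using False by (simp add: D_def mat_app_def rank_def)
    ultimately show ?thesis by simp
  next
    case True
    have "D 0 (\<lambda>k. f 0 * c k) 0 = f 0 * D 0 c 0" by (rule D_mult)
    then show ?thesis unfolding True c(2) by (simp only: mult.commute)
  qed
  then have *: "g * f j - D 0 (\<lambda>k. f 0 * c k) j \<in> var_ideal S" for j
    by (simp only: diff_self var_ideal_zero)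
  have "(\<lambda>k. f 0 * c k) \<in> E 1"
    by (rule free_mod_mult[OF free_mod_poly_ring[OF f(1)] c(1)])
  with * show ?thesis unfolding boundary_mod_def 0 One_nat_def by (intro bexI[of _ "\<lambda>k. f 0 * c k"] allI)
next
  case (Suc i')
  obtain h where h: "\<And>j k. h j k \<in> poly_ring n"
    and hom: "\<And>v j. v \<in> E (Suc i') \<Longrightarrow>
      D i' (\<lambda>k. g * v k - mat_app (rank (Suc i')) (rank i') h (D i' v) k) j = 0"
    using homotopy[OF assms(1)] by blast
  let ?hf = "mat_app (rank (Suc i')) (rank i') h (D i' f)"
  have g: "g \<in> poly_ring n" by (rule ideal_poly_ring[OF assms(1)])
  have fE: "f \<in> E (Suc i')" using f Suc by simp
  have "?hf \<in> E (Suc i')"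
    using h by (intro mat_app_free_mod D_closed fE)
  then have "(\<lambda>k. g * f k - ?hf k) \<in> E (Suc i')"
    by (rule free_mod_diff[OF free_mod_mult[OF g fE]])
  moreover have "D i' (\<lambda>k. g * f k - ?hf k) = (\<lambda>_. 0)"
    by (rule ext) (rule hom[OF fE])
  ultimately have "(\<lambda>k. g * f k - ?hf k) \<in> D (Suc i') ` E (Suc (Suc i'))"
    unfolding exact by blast
  then obtain w where w: "w \<in> E (Suc (Suc i'))" and eq: "(\<lambda>k. g * f k - ?hf k) = D (Suc i') w"
    by (rule imageE)
  have "g * f j - D (Suc i') w j = ?hf j" for j
    by (simp flip: eq)
  also have "?hf j \<in> var_ideal S" for j
    using f(2)[OF Suc] by (rule mat_app_var_ideal)
  finally show ?thesis using w Suc unfolding boundary_mod_def by blast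
qed

lemma acyclic_above_remove:
  assumes ac: "acyclic_above (insert r S)" and r: "r \<notin> S" "r \<le> n"
    and g: "g \<in> J" "g - var r ^ N \<in> var_ideal S"
  shows "acyclic_above S"
  unfolding acyclic_above_def
proof (intro allI impI, elim conjE)
  fix i f assume f: "f \<in> E i" "order_ge (deg i) f"
    and "\<forall>i' j. i = Suc i' \<longrightarrow> D i' f j \<in> var_ideal S"
  then have "boundary_mod S i (\<lambda>j. g * f j)" by (intro boundary_mod_mult_ideal g) auto
  then obtain w where w: "w \<in> E (Suc i)" "\<And>j. g * f j - D i w j \<in> var_ideal S"
    by (auto simp: boundary_mod_def)
  \<comment> \<open>\<open>X_r^N\<close> and \<open>g\<close> act alike modulo \<open>S\<close>, so
    the boundary for \<open>g f\<close> also serves for \<open>X_r^N f\<close>.\<close>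
  have "var r ^ N * f j - D i w j = (g * f j - D i w j) - f j * (g - var r ^ N)" for j
    by (simp add: algebra_simps)
  also have "\<dots> j \<in> var_ideal S" for j
    by (intro var_ideal_diff var_ideal_mult g w)
  finally have "boundary_mod S i (\<lambda>j. var r ^ N * f j)"
    using w(1) by (auto simp: boundary_mod_def)
  then show "boundary_mod S i f" by (rule boundary_mod_power[OF ac r f])
qed

text \<open>The start of the descent: modulo all variables only constants survive, and
  \<open>deg i\<close> is at least 1, so every admissible \<open>f\<close> is already 0.\<close>

lemma acyclic_above_atMost: "acyclic_above {..n}"
  unfolding acyclic_above_def
proof (intro allI impI, elim conjE)
  fix i f assume f: "f \<in> E i" "order_ge (deg i) f"
  have "f j \<in> var_ideal {..n}" for j
    unfolding var_ideal_def
  proof safe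
    fix m assume m: "m \<in> Poly_Mapping.keys (f j)" and disj: "Poly_Mapping.keys m \<inter> {..n} = {}"
    have "mon_degree m \<noteq> 0" using f(2) m by (force simp: order_ge_def deg_def split: if_splits)
    moreover have "Poly_Mapping.keys m \<subseteq> {..n}"
      using free_mod_poly_ring[OF f(1), of j] m by (auto simp: poly_ring_def)
    ultimately show False using disj by (simp add: Int_absorb2 mon_degree_eq_0_iff)
  qed
  moreover have "(\<lambda>_. 0) \<in> E (Suc i)" by (simp add: free_mod_def)
  moreover have "D i (\<lambda>_. 0) = (\<lambda>_. 0)" by (simp add: D_def fun_eq_iff)
  ultimately show "boundary_mod {..n} i f" unfolding boundary_mod_def by (metis diff_zero)
qed

text \<open>This is the case \<open>i = 0\<close> of \<open>acyclic_above S\<close>. The variables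
  outside \<open>S\<close> can be released in any order, because the congruence in
  \<open>pow\<close> modulo \<open>S\<close> persists modulo larger sets of variables.\<close>

lemma quadric_in_ideal_mod_vars:
  assumes "S \<subseteq> {..n}"
    and pow: "\<And>r. r \<le> n \<Longrightarrow> r \<notin> S \<Longrightarrow> \<exists>N. \<exists>g\<in>J. g - var r ^ N \<in> var_ideal S"
    and f: "f \<in> forms n 2"
  obtains g where "g \<in> J \<inter> forms n 2" "f - g \<in> var_ideal S"
proof -
  \<comment> \<open>\<open>B\<close> collects the variables released so far.\<close>
  have "acyclic_above ({..n} - B)" if "finite B" "B \<subseteq> {..n} - S" for B
    using that
  proof induction
    case empty
    then show ?case by (simp add: acyclic_above_atMost)
  next
    case (insert r B)
    let ?S = "{..n} - insert r B"
    have r: "r \<le> n" "r \<notin> S" using insert by auto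
    then have "insert r ?S = {..n} - B" using insert by auto
    then have ac: "acyclic_above (insert r ?S)" using insert by auto
    obtain N g where g: "g \<in> J" "g - var r ^ N \<in> var_ideal S" using pow[OF r] by blast
    have "g - var r ^ N \<in> var_ideal ?S"
      by (rule var_ideal_mono[OF g(2)]) (use insert.prems assms(1) in auto)
    then show ?case using acyclic_above_remove[OF ac _ r(1) g(1)] by auto
  qed
  from this[of "{..n} - S"] have ac: "acyclic_above S"
    using assms(1) by (simp add: double_diff)
  define F where "F = (\<lambda>j::nat. if j = 0 then f else 0)"
  have "F \<in> E 0" using f by (auto simp: F_def free_mod_def rank_def forms_def)
  moreover have "order_ge (deg 0) F"
    using f by (auto simp: F_def order_ge_def deg_def forms_def)
  ultimately have "boundary_mod S 0 F" using ac by (auto simp: acyclic_above_def)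
  then obtain v where v: "v \<in> E 1" and Fv: "F 0 - D 0 v 0 \<in> var_ideal S"
    by (auto simp: boundary_mod_def)
  \<comment> \<open>Only the degree 2 part of the congruence is kept; as the \<open>q k\<close> are
    quadrics, it involves just the constant parts of the coefficients.\<close>
  define v0 where "v0 = (\<lambda>j. Poly_Mapping.single (0::nat \<Rightarrow>\<^sub>0 nat) (Poly_Mapping.lookup (v j) 0))"
  have v0_forms: "v0 j \<in> forms n 0" for j
    by (auto simp: v0_def forms_def poly_ring_def)
  have v0: "v0 \<in> E 1"
    using v v0_forms by (auto simp: free_mod_def forms_def) (simp add: v0_def)
  have "mat 0 0 k * v0 k \<in> forms n 2" if "k < rank 1" for k
    using forms_mult[OF mat_forms[of 0 0 k] v0_forms[of k]] that by (simp add: rank_def deg_def)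
  then have D_v0: "D 0 v0 0 \<in> forms n 2"
    by (auto simp: D_def mat_app_def intro!: forms_sum)
  have "f - D 0 v0 0 \<in> var_ideal S"
    unfolding var_ideal_def
  proof safe
    fix m assume m: "m \<in> Poly_Mapping.keys (f - D 0 v0 0)" and disj: "Poly_Mapping.keys m \<inter> S = {}"
    then have deg_m: "mon_degree m = 2"
      using forms_diff[OF f D_v0] by (auto simp: forms_def)
    have "m \<notin> Poly_Mapping.keys (D 0 (\<lambda>k. v k - v0 k) 0)"
    proof
      assume "m \<in> Poly_Mapping.keys (D 0 (\<lambda>k. v k - v0 k) 0)"
      then obtain k where "k < b 0" "m \<in> Poly_Mapping.keys (q k * (v k - v0 k))"
        using keys_sum_general[of "\<lambda>k. q k * (v k - v0 k)" "{..<b 0}"] by (auto simp: D_0)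
      then obtain x y where xy: "m = x + y" "x \<in> Poly_Mapping.keys (q k)" "y \<in> Poly_Mapping.keys (v k - v0 k)"
        by (auto elim!: in_keys_multE)
      have "q k \<in> forms n 2"
        using mat_forms[of 0 0 k] \<open>k < b 0\<close> by (simp add: mat_def rank_def deg_def)
      then have "mon_degree y = 0" using xy deg_m by (simp add: mon_degree_add forms_def)
      then show False using xy(3) by (auto simp: mon_degree_eq_0_iff v0_def in_keys_iff lookup_minus)
    qed
    moreover have "D 0 v 0 = D 0 v0 0 + D 0 (\<lambda>k. v k - v0 k) 0" by (simp add: D_diff)
    ultimately have "m \<in> Poly_Mapping.keys (F 0 - D 0 v 0)"
      using m by (simp add: F_def in_keys_iff lookup_minus lookup_add)
    then show False using Fv disj by (auto simp: var_ideal_def)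
  qed
  then show thesis using that D_v0 v0 by (auto simp: mem_ideal_iff)
qed

end

section \<open>Regular functions and ideal sheaves\<close>

text \<open>An arbitrary coordinate vector of the point. The vanishing of a form at it, and the
  quotient of two forms of equal degree, do not depend on the choice.\<close>

definition rep :: "'k::field point \<Rightarrow> nat \<Rightarrow> 'k" where
  "rep P = (SOME v. v \<in> P)"

lemma mem_proj_point: "v \<in> proj_point v"
  unfolding proj_point_def by (intro CollectI exI[of _ 1]) simp

lemma rep_mem: "P \<in> proj_space n \<Longrightarrow> rep P \<in> P"
  unfolding rep_def proj_space_def using mem_proj_point by (metis imageE someI)

lemma mem_pointE:
  assumes "P \<in> proj_space n" "v \<in> P" "w \<in> P"
  obtains c where "c \<noteq> 0" "w = (\<lambda>i. c * v i)"
proof -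
  obtain u where "P = proj_point u" using assms(1) by (auto simp: proj_space_def)
  then obtain a b where "a \<noteq> 0" "b \<noteq> 0" "v = (\<lambda>i. a * u i)" "w = (\<lambda>i. b * u i)"
    using assms by (auto simp: proj_point_def)
  then have "b / a \<noteq> 0" "w = (\<lambda>i. b / a * v i)" by auto
  then show thesis by (rule that)
qed

lemma proj_point_subset_coords:
  assumes "P \<in> proj_space n" "v \<in> P"
  shows "v \<in> coords n"
  using assms by (auto simp: proj_space_def proj_point_def coords_def)

lemma peval_nonzero_iff:
  assumes "P \<in> proj_space n" "v \<in> P" "w \<in> P" "f \<in> forms n l"
  shows "peval f v = 0 \<longleftrightarrow> peval f w = 0"
  by (rule mem_pointE[OF assms(1-3)]) (simp add: peval_scale[OF assms(4)])

lemma peval_ratio: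
  assumes "P \<in> proj_space n" "v \<in> P" "w \<in> P" "a \<in> forms n l" "b \<in> forms n l"
  shows "peval a v / peval b v = peval a w / peval b w"
  by (rule mem_pointE[OF assms(1-3)]) (simp add: peval_scale[OF assms(4)] peval_scale[OF assms(5)])

lemma mem_basic_open_iff:
  assumes "f \<in> forms n l"
  shows "P \<in> basic_open n f \<longleftrightarrow> P \<in> proj_space n \<and> peval f (rep P) \<noteq> 0"
proof (cases "P \<in> proj_space n")
  case True
  have "peval f v \<noteq> 0 \<longleftrightarrow> peval f (rep P) \<noteq> 0" if "v \<in> P" for v
    using peval_nonzero_iff[OF True that rep_mem[OF True] assms] by simp
  then show ?thesis using True rep_mem[OF True] unfolding basic_open_def by blast
qed (simp add: basic_open_def)

lemma openin_basic_open: "f \<in> forms n l \<Longrightarrow> openin (zariski n) (basic_open n f)"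
  unfolding zariski_def by (rule topology_generated_by_Basis) blast

lemma basic_open_one: "basic_open n 1 = proj_space n"
  by (auto simp: basic_open_def)

lemma topspace_zariski [simp]: "topspace (zariski n) = (proj_space n :: 'k::field point set)"
proof
  show "topspace (zariski n) \<subseteq> (proj_space n :: 'k point set)"
    unfolding zariski_def topology_generated_by_topspace by (auto simp: basic_open_def)
  show "(proj_space n :: 'k point set) \<subseteq> topspace (zariski n)"
    using openin_subset[OF openin_basic_open[OF forms_one]] by (simp add: basic_open_one)
qed

lemma openin_proj_space: "openin (zariski n) (proj_space n)"
  using openin_basic_open[OF forms_one] by (simp add: basic_open_one)

text \<open>The generating family is even a basis, since the product of two forms defines the
  intersection of their basic open sets.\<close>

lemma openin_zariskiE:
  fixes P :: "'k::field point"
  assumes "openin (zariski n) U" "P \<in> U"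
  obtains l g where "g \<in> forms n l" "P \<in> basic_open n g" "basic_open n g \<subseteq> U"
proof -
  have "generate_topology_on {basic_open n f | f l. f \<in> (forms n l :: 'k mpoly set)} U"
    using assms(1) unfolding zariski_def by (rule openin_topology_generated_by)
  then have "\<forall>P\<in>U. \<exists>l g. g \<in> forms n l \<and> P \<in> basic_open n g \<and> basic_open n g \<subseteq> U"
  proof induction
    case (Int a b)
    show ?case
    proof
      fix P assume "P \<in> a \<inter> b"
      then have "P \<in> a" "P \<in> b" by auto
      from bspec[OF Int(3) this(1)] bspec[OF Int(4) this(2)]
      obtain l g l' g' where g: "g \<in> forms n l" "P \<in> basic_open n g" "basic_open n g \<subseteq> a"
        and g': "g' \<in> forms n l'" "P \<in> basic_open n g'" "basic_open n g' \<subseteq> b"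
        by blast
      have "basic_open n (g * g') = basic_open n g \<inter> basic_open n g'"
        by (auto simp: basic_open_def peval_mult)
      then show "\<exists>l g. g \<in> forms n l \<and> P \<in> basic_open n g \<and> basic_open n g \<subseteq> a \<inter> b"
        using g g' forms_mult[OF g(1) g'(1)] by blast
    qed
  next
    case (UN K)
    show ?case
    proof
      fix P assume "P \<in> \<Union>K"
      then obtain k where "k \<in> K" "P \<in> k" by blast
      with UN(2) show "\<exists>l g. g \<in> forms n l \<and> P \<in> basic_open n g \<and> basic_open n g \<subseteq> \<Union>K"
        by (meson Union_upper subset_trans)
    qed
  qed blast+
  then show thesis using that assms(2) by blast
qed

section \<open>Regular functions\<close>

lemma regularE:
  assumes "f \<in> regular n W" "P \<in> W"
  obtains N a l b where "openin (zariski n) N" "P \<in> N" "a \<in> forms n l" "b \<in> forms n l"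
    "\<forall>Q v. Q \<in> N \<longrightarrow> Q \<in> W \<longrightarrow> v \<in> Q \<longrightarrow> peval b v \<noteq> 0 \<and> f Q = peval a v / peval b v"
proof -
  from assms obtain N a l b where N: "openin (zariski n) N" "P \<in> N" "a \<in> forms n l" "b \<in> forms n l"
    and *: "\<forall>Q\<in>N \<inter> W. \<forall>v\<in>Q. peval b v \<noteq> 0 \<and> f Q = peval a v / peval b v"
    unfolding regular_def by blast
  have "\<forall>Q v. Q \<in> N \<longrightarrow> Q \<in> W \<longrightarrow> v \<in> Q \<longrightarrow> peval b v \<noteq> 0 \<and> f Q = peval a v / peval b v"
    using * by blast
  then show thesis by (rule that[OF N])
qed

lemma regular_extensional: "f \<in> regular n W \<Longrightarrow> f \<in> extensional W"
  by (simp add: regular_def)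

lemma regularI:
  assumes "f \<in> extensional W"
    and "\<And>P. P \<in> W \<Longrightarrow> \<exists>N l a b. openin (zariski n) N \<and> P \<in> N \<and> a \<in> forms n l \<and> b \<in> forms n l \<and>
     (\<forall>Q v. Q \<in> N \<longrightarrow> Q \<in> W \<longrightarrow> v \<in> Q \<longrightarrow> peval b v \<noteq> 0 \<and> f Q = peval a v / peval b v)"
  shows "f \<in> regular n W"
proof -
  have "\<exists>N l a b. openin (zariski n) N \<and> P \<in> N \<and> a \<in> forms n l \<and> b \<in> forms n l \<and>
     (\<forall>Q\<in>N \<inter> W. \<forall>v\<in>Q. peval b v \<noteq> 0 \<and> f Q = peval a v / peval b v)" if "P \<in> W" for P
    using assms(2)[OF that] by (elim exE conjE, intro exI conjI) (assumption+, blast)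
  then show ?thesis using assms(1) unfolding regular_def by blast
qed

lemma regular_restrict:
  assumes "f \<in> regular n W" "V \<subseteq> W"
  shows "restrict f V \<in> regular n V"
proof (rule regularI)
  fix P assume "P \<in> V"
  then have "P \<in> W" using assms(2) by blast
  then obtain N a l b where N: "openin (zariski n) N" "P \<in> N" "a \<in> forms n l" "b \<in> forms n l"
    "\<forall>Q v. Q \<in> N \<longrightarrow> Q \<in> W \<longrightarrow> v \<in> Q \<longrightarrow> peval b v \<noteq> 0 \<and> f Q = peval a v / peval b v"
    by (rule regularE[OF assms(1)])
  show "\<exists>N l a b. openin (zariski n) N \<and> P \<in> N \<and> a \<in> forms n l \<and> b \<in> forms n l \<and>
     (\<forall>Q v. Q \<in> N \<longrightarrow> Q \<in> V \<longrightarrow> v \<in> Q \<longrightarrow> peval b v \<noteq> 0 \<and> restrict f V Q = peval a v / peval b v)"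
  proof (intro exI conjI allI impI)
    fix Q v assume Q: "Q \<in> N" "Q \<in> V" "v \<in> Q"
    then have "Q \<in> W" using assms(2) by blast
    with Q N(5) show "peval b v \<noteq> 0" "restrict f V Q = peval a v / peval b v" by simp_all
  qed fact+
qed simp

lemma regular_frac:
  assumes "W \<subseteq> proj_space n" "a \<in> forms n l" "b \<in> forms n l" "\<And>P. P \<in> W \<Longrightarrow> peval b (rep P) \<noteq> 0"
  shows "(\<lambda>P\<in>W. peval a (rep P) / peval b (rep P)) \<in> regular n W"
  unfolding regular_def
proof (intro CollectI conjI ballI exI)
  fix P assume "P \<in> W"
  show "openin (zariski n) (proj_space n :: 'a point set)" by (rule openin_proj_space)
  show "P \<in> proj_space n" using \<open>P \<in> W\<close> assms by blast
  show "a \<in> forms n l" "b \<in> forms n l" by fact+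
  fix Q v assume Q: "Q \<in> proj_space n \<inter> W" "v \<in> Q"
  show "peval b v \<noteq> 0"
    using assms(4)[of Q] peval_nonzero_iff[OF _ _ _ assms(3), of Q v "rep Q"] Q rep_mem[of Q n] by blast
  show "(\<lambda>P\<in>W. peval a (rep P) / peval b (rep P)) Q = peval a v / peval b v"
    using peval_ratio[OF _ _ _ assms(2,3), of Q v "rep Q"] Q rep_mem[of Q n] by auto
qed auto

lemma regular_const:
  assumes "W \<subseteq> proj_space n"
  shows "(\<lambda>P\<in>W. c) \<in> regular n W"
proof -
  have "Poly_Mapping.single 0 c \<in> forms n 0" by (auto simp: forms_def poly_ring_def)
  from regular_frac[OF assms this forms_one] show ?thesis by simp
qed

text \<open>Over the denominator \<open>b * b'\<close> both numerators have the same degree, so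
  their sum is again a form.\<close>

lemma regular_common_denominatorE:
  assumes f: "f \<in> regular n W" and g: "g \<in> regular n W" and P: "P \<in> W"
  obtains N a l a' b where "openin (zariski n) N" "P \<in> N"
    "a \<in> forms n l" "a' \<in> forms n l" "b \<in> forms n l"
    "\<forall>Q v. Q \<in> N \<longrightarrow> Q \<in> W \<longrightarrow> v \<in> Q \<longrightarrow> peval b v \<noteq> 0 \<and> f Q = peval a v / peval b v \<and> g Q = peval a' v / peval b v"
proof -
  obtain N a l b where 1: "openin (zariski n) N" "P \<in> N" "a \<in> forms n l" "b \<in> forms n l"
    "\<forall>Q v. Q \<in> N \<longrightarrow> Q \<in> W \<longrightarrow> v \<in> Q \<longrightarrow> peval b v \<noteq> 0 \<and> f Q = peval a v / peval b v"
    by (rule regularE[OF f P])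
  obtain N' a' l' b' where 2: "openin (zariski n) N'" "P \<in> N'" "a' \<in> forms n l'" "b' \<in> forms n l'"
    "\<forall>Q v. Q \<in> N' \<longrightarrow> Q \<in> W \<longrightarrow> v \<in> Q \<longrightarrow> peval b' v \<noteq> 0 \<and> g Q = peval a' v / peval b' v"
    by (rule regularE[OF g P])
  show thesis
  proof (rule that[of "N \<inter> N'" "a * b'" "l + l'" "b * a'" "b * b'"])
    show "openin (zariski n) (N \<inter> N')" "P \<in> N \<inter> N'" using 1 2 by auto
    show "a * b' \<in> forms n (l + l')" "b * a' \<in> forms n (l + l')" "b * b' \<in> forms n (l + l')"
      by (intro forms_mult 1 2)+
    have "peval (b * b') v \<noteq> 0 \<and> f Q = peval (a * b') v / peval (b * b') v \<and> g Q = peval (b * a') v / peval (b * b') v"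
      if Q: "Q \<in> N" "Q \<in> N'" "Q \<in> W" "v \<in> Q" for Q v
      using 1(5)[rule_format, of Q v] 2(5)[rule_format, of Q v] Q by (simp add: peval_mult)
    then show "\<forall>Q v. Q \<in> N \<inter> N' \<longrightarrow> Q \<in> W \<longrightarrow> v \<in> Q \<longrightarrow>
        peval (b * b') v \<noteq> 0 \<and> f Q = peval (a * b') v / peval (b * b') v \<and> g Q = peval (b * a') v / peval (b * b') v"
      by blast
  qed
qed

lemma
  assumes f: "f \<in> regular n W" and g: "g \<in> regular n W"
  shows regular_add: "(\<lambda>P\<in>W. f P + g P) \<in> regular n W"
    and regular_mult: "(\<lambda>P\<in>W. f P * g P) \<in> regular n W"
proof -
  show "(\<lambda>P\<in>W. f P + g P) \<in> regular n W"
  proof (rule regularI)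
    fix P assume "P \<in> W"
    then obtain N a l a' b where 1: "openin (zariski n) N" "P \<in> N"
      "a \<in> forms n l" "a' \<in> forms n l" "b \<in> forms n l"
      "\<forall>Q v. Q \<in> N \<longrightarrow> Q \<in> W \<longrightarrow> v \<in> Q \<longrightarrow> peval b v \<noteq> 0 \<and> f Q = peval a v / peval b v \<and> g Q = peval a' v / peval b v"
      by (rule regular_common_denominatorE[OF f g])
    show "\<exists>N l a b. openin (zariski n) N \<and> P \<in> N \<and> a \<in> forms n l \<and> b \<in> forms n l \<and>
       (\<forall>Q v. Q \<in> N \<longrightarrow> Q \<in> W \<longrightarrow> v \<in> Q \<longrightarrow> peval b v \<noteq> 0 \<and> (\<lambda>P\<in>W. f P + g P) Q = peval a v / peval b v)"
    proof (intro exI conjI allI impI)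
      show "a + a' \<in> forms n l" by (intro forms_add 1)
      fix Q v assume Q: "Q \<in> N" "Q \<in> W" "v \<in> Q"
      show "peval b v \<noteq> 0" using 1(6)[rule_format, OF Q] by simp
      show "(\<lambda>P\<in>W. f P + g P) Q = peval (a + a') v / peval b v"
        using Q(2) 1(6)[rule_format, OF Q] by (simp add: peval_add add_divide_distrib)
    qed fact+
  qed simp
  show "(\<lambda>P\<in>W. f P * g P) \<in> regular n W"
  proof (rule regularI)
    fix P assume "P \<in> W"
    then obtain N a l a' b where 1: "openin (zariski n) N" "P \<in> N"
      "a \<in> forms n l" "a' \<in> forms n l" "b \<in> forms n l"
      "\<forall>Q v. Q \<in> N \<longrightarrow> Q \<in> W \<longrightarrow> v \<in> Q \<longrightarrow> peval b v \<noteq> 0 \<and> f Q = peval a v / peval b v \<and> g Q = peval a' v / peval b v"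
      by (rule regular_common_denominatorE[OF f g])
    show "\<exists>N l a b. openin (zariski n) N \<and> P \<in> N \<and> a \<in> forms n l \<and> b \<in> forms n l \<and>
       (\<forall>Q v. Q \<in> N \<longrightarrow> Q \<in> W \<longrightarrow> v \<in> Q \<longrightarrow> peval b v \<noteq> 0 \<and> (\<lambda>P\<in>W. f P * g P) Q = peval a v / peval b v)"
    proof (intro exI conjI allI impI)
      show "a * a' \<in> forms n (l + l)" "b * b \<in> forms n (l + l)" by (intro forms_mult 1)+
      fix Q v assume Q: "Q \<in> N" "Q \<in> W" "v \<in> Q"
      show "peval (b * b) v \<noteq> 0" using 1(6)[rule_format, OF Q] by (simp add: peval_mult)
      show "(\<lambda>P\<in>W. f P * g P) Q = peval (a * a') v / peval (b * b) v"
        using Q(2) 1(6)[rule_format, OF Q] by (simp add: peval_mult)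
    qed fact+
  qed simp
qed

section \<open>Ideal sheaves and their squares\<close>

text \<open>Closure properties shared by \<open>I\<close> and its square; they make the operations
  on germs of the quotient well defined.\<close>

definition is_ideal_sheaf :: "nat \<Rightarrow> ('k::field point, 'k) ideal_sheaf \<Rightarrow> bool" where
  "is_ideal_sheaf n F \<longleftrightarrow>
    (\<forall>U V f. openin (zariski n) U \<and> openin (zariski n) V \<and> V \<subseteq> U \<and> f \<in> F U \<longrightarrow> restrict f V \<in> F V) \<and>
    (\<forall>U f g. openin (zariski n) U \<and> f \<in> F U \<and> g \<in> F U \<longrightarrow> (\<lambda>P\<in>U. f P + g P) \<in> F U) \<and>
    (\<forall>U a f. openin (zariski n) U \<and> a \<in> regular n U \<and> f \<in> F U \<longrightarrow> (\<lambda>P\<in>U. a P * f P) \<in> F U) \<and>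
    (\<forall>U. openin (zariski n) U \<longrightarrow> (\<lambda>P\<in>U. 0) \<in> F U)"

lemma
  assumes "is_ideal_sheaf n F" "openin (zariski n) U"
  shows ideal_sheaf_restrict: "openin (zariski n) V \<Longrightarrow> V \<subseteq> U \<Longrightarrow> f \<in> F U \<Longrightarrow> restrict f V \<in> F V"
    and ideal_sheaf_add: "f \<in> F U \<Longrightarrow> g \<in> F U \<Longrightarrow> (\<lambda>P\<in>U. f P + g P) \<in> F U"
    and ideal_sheaf_mult: "a \<in> regular n U \<Longrightarrow> f \<in> F U \<Longrightarrow> (\<lambda>P\<in>U. a P * f P) \<in> F U"
    and ideal_sheaf_zero: "(\<lambda>P\<in>U. 0) \<in> F U"
proof -
  note F = assms(1)[unfolded is_ideal_sheaf_def]
  show "openin (zariski n) V \<Longrightarrow> V \<subseteq> U \<Longrightarrow> f \<in> F U \<Longrightarrow> restrict f V \<in> F V"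
    using F[THEN conjunct1, rule_format, of U V f] assms(2) by simp
  show "f \<in> F U \<Longrightarrow> g \<in> F U \<Longrightarrow> (\<lambda>P\<in>U. f P + g P) \<in> F U"
    using F[THEN conjunct2, THEN conjunct1, rule_format, of U f g] assms(2) by simp
  show "a \<in> regular n U \<Longrightarrow> f \<in> F U \<Longrightarrow> (\<lambda>P\<in>U. a P * f P) \<in> F U"
    using F[THEN conjunct2, THEN conjunct2, THEN conjunct1, rule_format, of U a f] assms(2) by simp
  show "(\<lambda>P\<in>U. 0) \<in> F U"
    using F[THEN conjunct2, THEN conjunct2, THEN conjunct2, rule_format, of U] assms(2) by simp
qed

lemma ideal_sheaf_diff:
  assumes "is_ideal_sheaf n F" "openin (zariski n) U" "f \<in> F U" "g \<in> F U"
  shows "(\<lambda>P\<in>U. f P - g P) \<in> F U"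
proof -
  have "(\<lambda>P\<in>U. -1) \<in> regular n U"
    using openin_subset[OF assms(2)] by (intro regular_const) simp
  from ideal_sheaf_add[OF assms(1-3) ideal_sheaf_mult[OF assms(1,2) this assms(4)]]
  have "(\<lambda>P\<in>U. f P + (\<lambda>P\<in>U. (\<lambda>P\<in>U. -1) P * g P) P) \<in> F U" .
  also have "(\<lambda>P\<in>U. f P + (\<lambda>P\<in>U. (\<lambda>P\<in>U. -1) P * g P) P) = (\<lambda>P\<in>U. f P - g P)"
    by (rule restrict_ext) simp
  finally show ?thesis .
qed

lemma ideal_sheaf_vanishing:
  fixes X :: "'k::field point set"
  shows "is_ideal_sheaf n (vanishing_ideal n X)"
  unfolding is_ideal_sheaf_def
proof (intro conjI allI impI; (elim conjE)?)
  fix U V :: "'k point set" and f assume "V \<subseteq> U" "f \<in> vanishing_ideal n X U"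
  then show "restrict f V \<in> vanishing_ideal n X V"
    using regular_restrict[of f n U V] by (auto simp: vanishing_ideal_def)
next
  fix U :: "'k point set" and f g assume "f \<in> vanishing_ideal n X U" "g \<in> vanishing_ideal n X U"
  then show "(\<lambda>P\<in>U. f P + g P) \<in> vanishing_ideal n X U"
    using regular_add[of f n U g] by (simp add: vanishing_ideal_def)
next
  fix U :: "'k point set" and a f assume "a \<in> regular n U" "f \<in> vanishing_ideal n X U"
  then show "(\<lambda>P\<in>U. a P * f P) \<in> vanishing_ideal n X U"
    using regular_mult[of a n U f] by (simp add: vanishing_ideal_def)
next
  fix U :: "'k point set" assume "openin (zariski n) U"
  then show "(\<lambda>P\<in>U. 0) \<in> vanishing_ideal n X U"
    using regular_const[of U n 0] openin_subset[of "zariski n" U] by (simp add: vanishing_ideal_def)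
qed

lemma ideal_prod_restrict:
  assumes "f \<in> ideal_prod (str_sheaf n U) (F U) (F U)" "is_ideal_sheaf n F"
    "openin (zariski n) U" "openin (zariski n) V" "V \<subseteq> U"
  shows "restrict f V \<in> ideal_prod (str_sheaf n V) (F V) (F V)"
  using assms(1)
proof induction
  case (prod i j)
  have "restrict (i \<otimes>\<^bsub>str_sheaf n U\<^esub> j) V = restrict i V \<otimes>\<^bsub>str_sheaf n V\<^esub> restrict j V"
    using assms(5) by (auto simp: str_sheaf_def restrict_def fun_eq_iff)
  then show ?case
    using prod by (simp add: ideal_prod.prod ideal_sheaf_restrict[OF assms(2-5)])
next
  case (sum s t)
  have eq: "restrict (s \<oplus>\<^bsub>str_sheaf n U\<^esub> t) V = restrict s V \<oplus>\<^bsub>str_sheaf n V\<^esub> restrict t V"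
    using assms(5) by (auto simp: str_sheaf_def restrict_def fun_eq_iff)
  show ?case unfolding eq by (rule ideal_prod.sum[OF sum.IH])
qed

text \<open>\<open>ideal_prod\<close> is generated by products and sums, so the scalar is absorbed
  into the first factor of each product.\<close>

lemma ideal_prod_mult:
  assumes "f \<in> ideal_prod (str_sheaf n U) (F U) (F U)" "is_ideal_sheaf n F"
    "openin (zariski n) U" "a \<in> regular n U"
  shows "(\<lambda>P\<in>U. a P * f P) \<in> ideal_prod (str_sheaf n U) (F U) (F U)"
  using assms(1)
proof induction
  case (prod i j)
  have "(\<lambda>P\<in>U. a P * (i \<otimes>\<^bsub>str_sheaf n U\<^esub> j) P) = (\<lambda>P\<in>U. a P * i P) \<otimes>\<^bsub>str_sheaf n U\<^esub> j"
    by (auto simp: str_sheaf_def restrict_def fun_eq_iff)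
  then show ?case
    using prod by (simp add: ideal_prod.prod ideal_sheaf_mult[OF assms(2-4)])
next
  case (sum s t)
  have eq: "(\<lambda>P\<in>U. a P * (s \<oplus>\<^bsub>str_sheaf n U\<^esub> t) P)
      = (\<lambda>P\<in>U. a P * s P) \<oplus>\<^bsub>str_sheaf n U\<^esub> (\<lambda>P\<in>U. a P * t P)"
    by (auto simp: str_sheaf_def restrict_def fun_eq_iff distrib_left)
  show ?case unfolding eq by (rule ideal_prod.sum[OF sum.IH])
qed

lemma ideal_square_regular: "f \<in> ideal_square n F U \<Longrightarrow> f \<in> regular n U"
  by (simp add: ideal_square_def)

lemma ideal_squareE:
  assumes "f \<in> ideal_square n F U" "P \<in> U"
  obtains V where "openin (zariski n) V" "P \<in> V" "V \<subseteq> U"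
    "restrict f V \<in> ideal_prod (str_sheaf n V) (F V) (F V)"
  using assms unfolding ideal_square_def by blast

lemma ideal_sheaf_square:
  fixes F :: "('k::field point, 'k) ideal_sheaf"
  assumes F: "is_ideal_sheaf n F"
  shows "is_ideal_sheaf n (ideal_square n F)"
  unfolding is_ideal_sheaf_def
proof (intro conjI allI impI; (elim conjE)?)
  fix U V f assume UV: "openin (zariski n) U" "openin (zariski n) V" "V \<subseteq> U" and f: "f \<in> ideal_square n F U"
  show "restrict f V \<in> ideal_square n F V"
    unfolding ideal_square_def
  proof (intro CollectI conjI ballI)
    show "restrict f V \<in> regular n V" by (rule regular_restrict[OF ideal_square_regular[OF f] UV(3)])
    fix P assume "P \<in> V"
    then obtain W where W: "openin (zariski n) W" "P \<in> W" "W \<subseteq> U"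
      "restrict f W \<in> ideal_prod (str_sheaf n W) (F W) (F W)"
      using ideal_squareE[OF f, of P] UV by blast
    have "restrict (restrict f V) (W \<inter> V) = restrict (restrict f W) (W \<inter> V)"
      by (auto simp: restrict_def fun_eq_iff)
    then have "restrict (restrict f V) (W \<inter> V) \<in> ideal_prod (str_sheaf n (W \<inter> V)) (F (W \<inter> V)) (F (W \<inter> V))"
      using ideal_prod_restrict[OF W(4) F W(1), of "W \<inter> V"] W UV by auto
    then show "\<exists>Va. openin (zariski n) Va \<and> P \<in> Va \<and> Va \<subseteq> V \<and>
        restrict (restrict f V) Va \<in> ideal_prod (str_sheaf n Va) (F Va) (F Va)"
      using W UV \<open>P \<in> V\<close> by (intro exI[of _ "W \<inter> V"]) auto
  qed
next
  fix U f g assume U: "openin (zariski n) U" and f: "f \<in> ideal_square n F U" and g: "g \<in> ideal_square n F U"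
  show "(\<lambda>P\<in>U. f P + g P) \<in> ideal_square n F U"
    unfolding ideal_square_def
  proof (intro CollectI conjI ballI)
    show "(\<lambda>P\<in>U. f P + g P) \<in> regular n U"
      by (rule regular_add[OF ideal_square_regular[OF f] ideal_square_regular[OF g]])
    fix P assume P: "P \<in> U"
    obtain V where V: "openin (zariski n) V" "P \<in> V" "V \<subseteq> U"
      "restrict f V \<in> ideal_prod (str_sheaf n V) (F V) (F V)" using ideal_squareE[OF f P] by blast
    obtain W where W: "openin (zariski n) W" "P \<in> W" "W \<subseteq> U"
      "restrict g W \<in> ideal_prod (str_sheaf n W) (F W) (F W)" using ideal_squareE[OF g P] by blast
    let ?Z = "V \<inter> W"
    have Z: "openin (zariski n) ?Z" using V W by auto
    have "restrict (restrict f V) ?Z \<oplus>\<^bsub>str_sheaf n ?Z\<^esub> restrict (restrict g W) ?Z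
        \<in> ideal_prod (str_sheaf n ?Z) (F ?Z) (F ?Z)"
      by (intro ideal_prod.sum ideal_prod_restrict[OF V(4) F V(1)] ideal_prod_restrict[OF W(4) F W(1)] Z) auto
    also have "restrict (restrict f V) ?Z \<oplus>\<^bsub>str_sheaf n ?Z\<^esub> restrict (restrict g W) ?Z
        = restrict (\<lambda>P\<in>U. f P + g P) ?Z"
      using V W by (auto simp: str_sheaf_def restrict_def fun_eq_iff)
    finally show "\<exists>V. openin (zariski n) V \<and> P \<in> V \<and> V \<subseteq> U \<and>
        restrict (\<lambda>P\<in>U. f P + g P) V \<in> ideal_prod (str_sheaf n V) (F V) (F V)"
      using V W Z by (intro exI[of _ ?Z] conjI) blast+
  qed
next
  fix U a f assume U: "openin (zariski n) U" and a: "a \<in> regular n U" and f: "f \<in> ideal_square n F U"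
  show "(\<lambda>P\<in>U. a P * f P) \<in> ideal_square n F U"
    unfolding ideal_square_def
  proof (intro CollectI conjI ballI)
    show "(\<lambda>P\<in>U. a P * f P) \<in> regular n U"
      by (rule regular_mult[OF a ideal_square_regular[OF f]])
    fix P assume P: "P \<in> U"
    obtain V where V: "openin (zariski n) V" "P \<in> V" "V \<subseteq> U"
      "restrict f V \<in> ideal_prod (str_sheaf n V) (F V) (F V)" using ideal_squareE[OF f P] by blast
    have "(\<lambda>P\<in>V. restrict a V P * restrict f V P) \<in> ideal_prod (str_sheaf n V) (F V) (F V)"
      using ideal_prod_mult[OF V(4) F V(1) regular_restrict[OF a V(3)]] .
    also have "(\<lambda>P\<in>V. restrict a V P * restrict f V P) = restrict (\<lambda>P\<in>U. a P * f P) V"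
      using V by (auto simp: restrict_def fun_eq_iff)
    finally show "\<exists>V. openin (zariski n) V \<and> P \<in> V \<and> V \<subseteq> U \<and>
        restrict (\<lambda>P\<in>U. a P * f P) V \<in> ideal_prod (str_sheaf n V) (F V) (F V)"
      using V by blast
  qed
next
  fix U :: "'k point set" assume U: "openin (zariski n) U"
  have "(\<lambda>P\<in>U. 0) \<otimes>\<^bsub>str_sheaf n U\<^esub> (\<lambda>P\<in>U. 0) \<in> ideal_prod (str_sheaf n U) (F U) (F U)"
    by (intro ideal_prod.prod ideal_sheaf_zero[OF F U])
  also have "(\<lambda>P\<in>U. 0) \<otimes>\<^bsub>str_sheaf n U\<^esub> (\<lambda>P\<in>U. 0) = restrict (\<lambda>P\<in>U. 0) U"
    by (auto simp: str_sheaf_def restrict_def fun_eq_iff)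
  finally have "restrict (\<lambda>P\<in>U. 0) U \<in> ideal_prod (str_sheaf n U) (F U) (F U)" .
  moreover have "(\<lambda>P\<in>U. 0) \<in> regular n U"
    using regular_const[of U n 0] openin_subset[OF U] by simp
  ultimately show "(\<lambda>P\<in>U. 0) \<in> ideal_square n F U"
    unfolding ideal_square_def using U by blast
qed

section \<open>Germs and sections of a quotient sheaf\<close>

context
  fixes n :: nat and F G :: "('k::field point, 'k) ideal_sheaf"
  assumes F: "is_ideal_sheaf n F" and G: "is_ideal_sheaf n G"
begin

abbreviation "germ \<equiv> quot_germ (zariski n) F G"

text \<open>A germ is the whole class of its representatives, so equality is equality of sets. One
  inclusion is proved for arbitrary pairs; the other follows by negating the difference.\<close>

lemma quot_germ_eqI:
  assumes Z: "openin (zariski n) Z" "P \<in> Z" "Z \<subseteq> V" "Z \<subseteq> W" and d: "(\<lambda>Q\<in>Z. f Q - g Q) \<in> G Z"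
  shows "germ P V f = germ P W g"
proof -
  have sub: "germ P V f \<subseteq> germ P W g"
    if Z: "openin (zariski n) Z" "P \<in> Z" "Z \<subseteq> V" "Z \<subseteq> W" and d: "(\<lambda>Q\<in>Z. f Q - g Q) \<in> G Z" for f g V W
  proof
    fix x assume "x \<in> germ P V f"
    then obtain W' g' Z' where x: "x = (W', g')" "openin (zariski n) W'" "P \<in> W'" "g' \<in> F W'"
      and Z': "openin (zariski n) Z'" "P \<in> Z'" "Z' \<subseteq> V \<inter> W'" and d': "(\<lambda>Q\<in>Z'. f Q - g' Q) \<in> G Z'"
      by (auto simp: quot_germ_def)
    let ?Z = "Z \<inter> Z'"
    have op: "openin (zariski n) ?Z" using Z Z' by auto
    have "restrict (\<lambda>Q\<in>Z. f Q - g Q) ?Z \<in> G ?Z"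
      by (rule ideal_sheaf_restrict[OF G Z(1) op _ d]) blast
    moreover have "restrict (\<lambda>Q\<in>Z'. f Q - g' Q) ?Z \<in> G ?Z"
      by (rule ideal_sheaf_restrict[OF G Z'(1) op _ d']) blast
    ultimately
    have "(\<lambda>Q\<in>?Z. restrict (\<lambda>Q\<in>Z'. f Q - g' Q) ?Z Q - restrict (\<lambda>Q\<in>Z. f Q - g Q) ?Z Q) \<in> G ?Z"
      by (intro ideal_sheaf_diff[OF G op])
    also have "(\<lambda>Q\<in>?Z. restrict (\<lambda>Q\<in>Z'. f Q - g' Q) ?Z Q - restrict (\<lambda>Q\<in>Z. f Q - g Q) ?Z Q)
        = (\<lambda>Q\<in>?Z. g Q - g' Q)"
      by (rule restrict_ext) auto
    finally show "x \<in> germ P W g"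
      using x op Z Z' unfolding quot_germ_def by blast
  qed
  have "(\<lambda>Q\<in>Z. (\<lambda>P\<in>Z. 0) Q - (\<lambda>Q\<in>Z. f Q - g Q) Q) \<in> G Z"
    by (rule ideal_sheaf_diff[OF G Z(1) ideal_sheaf_zero[OF G Z(1)] d])
  also have "(\<lambda>Q\<in>Z. (\<lambda>P\<in>Z. 0) Q - (\<lambda>Q\<in>Z. f Q - g Q) Q) = (\<lambda>Q\<in>Z. g Q - f Q)"
    by (rule restrict_ext) auto
  finally show ?thesis using sub[OF Z d] sub[OF Z(1,2,4,3)] by blast
qed

lemma quot_germ_refl:
  assumes "openin (zariski n) U" "P \<in> U" "f \<in> F U"
  shows "(U, f) \<in> germ P U f"
  using assms ideal_sheaf_zero[OF G assms(1)] by (auto simp: quot_germ_def)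

lemma quot_germ_memE:
  assumes "(W, g) \<in> germ P V f"
  obtains Z where "openin (zariski n) Z" "P \<in> Z" "Z \<subseteq> V" "Z \<subseteq> W"
    "(\<lambda>Q\<in>Z. f Q - g Q) \<in> G Z"
  using assms by (auto simp: quot_germ_def)

text \<open>\<open>quot_add\<close> is a union over all pairs of representatives. It collapses
  because each pair gives the same germ.\<close>

lemma quot_add_germ:
  assumes U: "openin (zariski n) U" "P \<in> U" and f: "f \<in> F U" and g: "g \<in> F U"
  shows "quot_add (zariski n) F G P (germ P U f) (germ P U g) = germ P U (\<lambda>Q\<in>U. f Q + g Q)"
proof -
  have eq: "germ P (V \<inter> W) (\<lambda>Q\<in>V \<inter> W. f' Q + g' Q) = germ P U (\<lambda>Q\<in>U. f Q + g Q)"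
    if mem: "(V, f') \<in> germ P U f" "(W, g') \<in> germ P U g" for V f' W g'
  proof -
    obtain Z where Z: "openin (zariski n) Z" "P \<in> Z" "Z \<subseteq> U" "Z \<subseteq> V" "(\<lambda>Q\<in>Z. f Q - f' Q) \<in> G Z"
      by (rule quot_germ_memE[OF mem(1)])
    obtain Y where Y: "openin (zariski n) Y" "P \<in> Y" "Y \<subseteq> U" "Y \<subseteq> W" "(\<lambda>Q\<in>Y. g Q - g' Q) \<in> G Y"
      by (rule quot_germ_memE[OF mem(2)])
    have op: "openin (zariski n) (Z \<inter> Y)" using Z Y by auto
    have "(\<lambda>Q\<in>Z \<inter> Y. restrict (\<lambda>Q\<in>Z. f Q - f' Q) (Z \<inter> Y) Q + restrict (\<lambda>Q\<in>Y. g Q - g' Q) (Z \<inter> Y) Q) \<in> G (Z \<inter> Y)"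
      by (intro ideal_sheaf_add[OF G op] ideal_sheaf_restrict[OF G Z(1) op _ Z(5)]
          ideal_sheaf_restrict[OF G Y(1) op _ Y(5)]) auto
    also have "(\<lambda>Q\<in>Z \<inter> Y. restrict (\<lambda>Q\<in>Z. f Q - f' Q) (Z \<inter> Y) Q + restrict (\<lambda>Q\<in>Y. g Q - g' Q) (Z \<inter> Y) Q)
       = (\<lambda>Q\<in>Z \<inter> Y. (\<lambda>Q\<in>U. f Q + g Q) Q - (\<lambda>Q\<in>V \<inter> W. f' Q + g' Q) Q)"
      by (rule restrict_ext) (use Z Y in auto)
    finally have d: "(\<lambda>Q\<in>Z \<inter> Y. (\<lambda>Q\<in>U. f Q + g Q) Q - (\<lambda>Q\<in>V \<inter> W. f' Q + g' Q) Q) \<in> G (Z \<inter> Y)" .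
    show ?thesis
      by (rule sym, rule quot_germ_eqI[OF op _ _ _ d]) (use Z(2-4) Y(2-4) in auto)
  qed
  have f': "(U, f) \<in> germ P U f" and g': "(U, g) \<in> germ P U g"
    by (rule quot_germ_refl[OF U f], rule quot_germ_refl[OF U g])
  have "quot_add (zariski n) F G P (germ P U f) (germ P U g)
      = (\<Union>x\<in>germ P U f. \<Union>y\<in>germ P U g. germ P U (\<lambda>Q\<in>U. f Q + g Q))"
    unfolding quot_add_def
    by (intro SUP_cong refl) (clarify, intro SUP_cong refl, clarify, rule eq)
  \<comment> \<open>Both index sets are nonempty, otherwise the union of the constant family would
    be empty.\<close>
  also have "\<dots> = germ P U (\<lambda>Q\<in>U. f Q + g Q)"
    using ex_in_conv[THEN iffD1, OF exI, OF f'] ex_in_conv[THEN iffD1, OF exI, OF g']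
    by (simp only: UN_constant if_False)
  finally show ?thesis .
qed

lemma quot_smult_germ:
  assumes U: "openin (zariski n) U" "P \<in> U" and a: "a \<in> regular n U" and f: "f \<in> F U"
  shows "quot_smult (zariski n) F G U a P (germ P U f) = germ P U (\<lambda>Q\<in>U. a Q * f Q)"
proof -
  have eq: "germ P (U \<inter> V) (\<lambda>Q\<in>U \<inter> V. a Q * f' Q) = germ P U (\<lambda>Q\<in>U. a Q * f Q)"
    if mem: "(V, f') \<in> germ P U f" for V f'
  proof -
    obtain Z where Z: "openin (zariski n) Z" "P \<in> Z" "Z \<subseteq> U" "Z \<subseteq> V" "(\<lambda>Q\<in>Z. f Q - f' Q) \<in> G Z"
      by (rule quot_germ_memE[OF mem])
    have "(\<lambda>Q\<in>Z. restrict a Z Q * (\<lambda>Q\<in>Z. f Q - f' Q) Q) \<in> G Z"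
      by (intro ideal_sheaf_mult[OF G Z(1)] regular_restrict[OF a] Z)
    also have "(\<lambda>Q\<in>Z. restrict a Z Q * (\<lambda>Q\<in>Z. f Q - f' Q) Q)
       = (\<lambda>Q\<in>Z. (\<lambda>Q\<in>U. a Q * f Q) Q - (\<lambda>Q\<in>U \<inter> V. a Q * f' Q) Q)"
      by (rule restrict_ext) (use Z in \<open>auto simp: right_diff_distrib\<close>)
    finally have d: "(\<lambda>Q\<in>Z. (\<lambda>Q\<in>U. a Q * f Q) Q - (\<lambda>Q\<in>U \<inter> V. a Q * f' Q) Q) \<in> G Z" .
    show ?thesis
      by (rule sym, rule quot_germ_eqI[OF Z(1) _ _ _ d]) (use Z(2-4) in auto)
  qed
  have f': "(U, f) \<in> germ P U f" by (rule quot_germ_refl[OF U f])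
  have "quot_smult (zariski n) F G U a P (germ P U f)
      = (\<Union>x\<in>germ P U f. germ P U (\<lambda>Q\<in>U. a Q * f Q))"
    unfolding quot_smult_def by (intro SUP_cong refl) (clarify, rule eq)
  also have "\<dots> = germ P U (\<lambda>Q\<in>U. a Q * f Q)"
    using ex_in_conv[THEN iffD1, OF exI, OF f'] by (simp only: UN_constant if_False)
  finally show ?thesis .
qed

abbreviation "C \<equiv> quot_sheaf (zariski n) F G"

abbreviation "proj \<equiv> quot_proj (zariski n) F G"

lemma quot_proj_closed: "openin (zariski n) U \<Longrightarrow> f \<in> F U \<Longrightarrow> proj U f \<in> carrier (Sec C U)"
  by (auto simp: quot_sheaf_def quot_sections_def quot_proj_def)

lemma quot_proj_add:
  assumes "openin (zariski n) U" "f \<in> F U" "g \<in> F U"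
  shows "proj U (\<lambda>Q\<in>U. f Q + g Q) = proj U f \<oplus>\<^bsub>Sec C U\<^esub> proj U g"
  unfolding quot_sheaf_def quot_proj_def
  using assms by (auto simp: quot_add_germ intro!: restrict_ext)

lemma quot_proj_smult:
  assumes "openin (zariski n) U" "a \<in> regular n U" "f \<in> F U"
  shows "proj U (\<lambda>Q\<in>U. a Q * f Q) = a \<odot>\<^bsub>Sec C U\<^esub> proj U f"
  unfolding quot_sheaf_def quot_proj_def
  using assms by (auto simp: quot_smult_germ intro!: restrict_ext)

lemma quot_proj_eq_zero:
  assumes "openin (zariski n) U" "f \<in> G U"
  shows "proj U f = proj U (\<lambda>Q\<in>U. 0)"
  unfolding quot_proj_def
proof (rule restrict_ext)
  fix P assume "P \<in> U"
  have "(\<lambda>Q\<in>U. f Q - (\<lambda>Q\<in>U. 0) Q) \<in> G U"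
    by (rule ideal_sheaf_diff[OF G assms ideal_sheaf_zero[OF G assms(1)]])
  then show "germ P U f = germ P U (\<lambda>Q\<in>U. 0)"
    using assms(1) \<open>P \<in> U\<close> by (intro quot_germ_eqI) auto
qed

lemma quot_sections_locallyE:
  assumes "s \<in> carrier (Sec C U)" "P \<in> U"
  obtains V f where "openin (zariski n) V" "P \<in> V" "V \<subseteq> U" "f \<in> F V" "Res C U V s = proj V f"
proof -
  obtain V f where V: "openin (zariski n) V" "P \<in> V" "V \<subseteq> U" "f \<in> F V" "\<forall>Q\<in>V. s Q = germ Q V f"
    using assms by (auto simp: quot_sheaf_def quot_sections_def)
  moreover have "Res C U V s = proj V f"
    using V(5) by (auto simp: quot_sheaf_def quot_proj_def intro!: restrict_ext)
  ultimately show thesis using that by blast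
qed

lemma quot_proj_restrict:
  assumes "openin (zariski n) U" "openin (zariski n) V" "V \<subseteq> U" "f \<in> F U"
  shows "Res C U V (proj U f) = proj V (restrict f V)"
proof -
  have "germ P U f = germ P V (restrict f V)" if "P \<in> V" for P
  proof -
    have "(\<lambda>Q\<in>V. f Q - restrict f V Q) = (\<lambda>Q\<in>V. 0)" by (rule restrict_ext) simp
    then show ?thesis
      using assms that ideal_sheaf_zero[OF G assms(2)] by (intro quot_germ_eqI[of V]) auto
  qed
  then show ?thesis using assms(3) by (auto simp: quot_sheaf_def quot_proj_def restrict_def fun_eq_iff)
qed

end

section \<open>Sections of a double structure\<close>

lemma is_module_sheaf_module:
  assumes "is_module_sheaf T \<O> S" "openin T U"
  shows "Module.module (\<O> U) (Sec S U)"
  using assms(1)[unfolded is_module_sheaf_def, THEN conjunct1] assms(2) by simp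

lemma is_module_sheaf_Res_trans:
  assumes "is_module_sheaf T \<O> S" "openin T U" "openin T V" "openin T W" "W \<subseteq> V" "V \<subseteq> U"
    "s \<in> carrier (Sec S U)"
  shows "Res S V W (Res S U V s) = Res S U W s"
proof -
  have "\<forall>U V W s. openin T U \<and> openin T V \<and> openin T W \<and> W \<subseteq> V \<and> V \<subseteq> U \<and>
      s \<in> carrier (Sec S U) \<longrightarrow> Res S V W (Res S U V s) = Res S U W s"
    using assms(1) unfolding is_module_sheaf_def by (elim conjE)
  from this[rule_format, of U V W s] show ?thesis using assms(2-) by simp
qed

lemma
  assumes "module_sheaf_hom T \<O> S S' \<phi>" "openin T U"
  shows module_sheaf_hom_closed: "s \<in> carrier (Sec S U) \<Longrightarrow> \<phi> U s \<in> carrier (Sec S' U)"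
    and module_sheaf_hom_add: "s \<in> carrier (Sec S U) \<Longrightarrow> t \<in> carrier (Sec S U) \<Longrightarrow>
      \<phi> U (s \<oplus>\<^bsub>Sec S U\<^esub> t) = \<phi> U s \<oplus>\<^bsub>Sec S' U\<^esub> \<phi> U t"
    and module_sheaf_hom_smult: "a \<in> carrier (\<O> U) \<Longrightarrow> s \<in> carrier (Sec S U) \<Longrightarrow>
      \<phi> U (a \<odot>\<^bsub>Sec S U\<^esub> s) = a \<odot>\<^bsub>Sec S' U\<^esub> \<phi> U s"
    and module_sheaf_hom_Res: "openin T V \<Longrightarrow> V \<subseteq> U \<Longrightarrow> s \<in> carrier (Sec S U) \<Longrightarrow>
      \<phi> V (Res S U V s) = Res S' U V (\<phi> U s)"
proof -
  note 1 = assms(1)[unfolded module_sheaf_hom_def, THEN conjunct1, rule_format, OF assms(2)]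
  note 2 = assms(1)[unfolded module_sheaf_hom_def, THEN conjunct2, rule_format, of U V]
  show "s \<in> carrier (Sec S U) \<Longrightarrow> \<phi> U s \<in> carrier (Sec S' U)"
    using 1 by blast
  show "s \<in> carrier (Sec S U) \<Longrightarrow> t \<in> carrier (Sec S U) \<Longrightarrow>
      \<phi> U (s \<oplus>\<^bsub>Sec S U\<^esub> t) = \<phi> U s \<oplus>\<^bsub>Sec S' U\<^esub> \<phi> U t"
    using 1 by blast
  show "a \<in> carrier (\<O> U) \<Longrightarrow> s \<in> carrier (Sec S U) \<Longrightarrow>
      \<phi> U (a \<odot>\<^bsub>Sec S U\<^esub> s) = a \<odot>\<^bsub>Sec S' U\<^esub> \<phi> U s"
    using 1 by blast
  show "openin T V \<Longrightarrow> V \<subseteq> U \<Longrightarrow> s \<in> carrier (Sec S U) \<Longrightarrow>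
      \<phi> V (Res S U V s) = Res S' U V (\<phi> U s)"
    using 2 assms(2) by blast
qed

lemma carrier_str_sheaf [simp]: "carrier (str_sheaf n W) = regular n W"
  and zero_str_sheaf: "\<zero>\<^bsub>str_sheaf n W\<^esub> = (\<lambda>P\<in>W. 0)"
  by (simp_all add: str_sheaf_def)

lemma push_forward_simps:
  "carrier (Sec (push_forward X L) U) = carrier (Sec L (U \<inter> X))"
  "add (Sec (push_forward X L) U) = add (Sec L (U \<inter> X))"
  "zero (Sec (push_forward X L) U) = zero (Sec L (U \<inter> X))"
  "smult (Sec (push_forward X L) U) = (\<lambda>a s. restrict a (U \<inter> X) \<odot>\<^bsub>Sec L (U \<inter> X)\<^esub> s)"
  "Res (push_forward X L) U V = Res L (U \<inter> X) (V \<inter> X)"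
  by (simp_all add: push_forward_def)

locale double_str =
  fixes n :: nat and X :: "'k::field point set" and L :: "('k point, 'k, 'm) module_sheaf"
    and p and J :: "('k point, 'k) ideal_sheaf"
  assumes double_structure: "double_structure n X L p J" and X: "X \<subseteq> proj_space n"
begin

abbreviation "T \<equiv> zariski n :: 'k point topology"
abbreviation "I \<equiv> vanishing_ideal n X"
abbreviation "I2 \<equiv> ideal_square n I"
abbreviation "conormal \<equiv> quot_sheaf T I I2"
abbreviation "pr \<equiv> quot_proj T I I2"

lemmas I = ideal_sheaf_vanishing[of n X]
lemmas I2 = ideal_sheaf_square[OF I]

lemma L: "line_bundle (subtopology T X) (str_sheaf n) L"
  and hom: "module_sheaf_hom T (str_sheaf n) conormal (push_forward X L) p"
  and surj: "surjective_sheaf_map T conormal (push_forward X L) p"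
  and mem_J_iff: "openin T U \<Longrightarrow> f \<in> J U \<longleftrightarrow> f \<in> I U \<and> p U (pr U f) = \<zero>\<^bsub>Sec L (U \<inter> X)\<^esub>"
proof -
  note ds = double_structure[unfolded double_structure_def Let_def]
  show "line_bundle (subtopology T X) (str_sheaf n) L" using ds by (rule conjunct1)
  show "module_sheaf_hom T (str_sheaf n) conormal (push_forward X L) p"
    using ds[THEN conjunct2] by (rule conjunct1)
  show "surjective_sheaf_map T conormal (push_forward X L) p"
    using ds[THEN conjunct2, THEN conjunct2] by (rule conjunct1)
  show "f \<in> J U \<longleftrightarrow> f \<in> I U \<and> p U (pr U f) = \<zero>\<^bsub>Sec L (U \<inter> X)\<^esub>" if "openin T U"
    using ds[THEN conjunct2, THEN conjunct2, THEN conjunct2, rule_format, OF that]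
    by (simp add: push_forward_simps)
qed

lemma L_sheaf: "is_module_sheaf (subtopology T X) (str_sheaf n) L"
  using L unfolding line_bundle_def by (rule conjunct1)

lemma openin_inter_X: "openin T U \<Longrightarrow> openin (subtopology T X) (U \<inter> X)"
  by (auto simp: openin_subtopology)

lemma module_L: "openin T U \<Longrightarrow> Module.module (str_sheaf n (U \<inter> X)) (Sec L (U \<inter> X))"
  by (rule is_module_sheaf_module[OF L_sheaf openin_inter_X])

lemma p_closed: "openin T U \<Longrightarrow> f \<in> I U \<Longrightarrow> p U (pr U f) \<in> carrier (Sec L (U \<inter> X))"
  using module_sheaf_hom_closed[OF hom _ quot_proj_closed[OF I I2]] by (simp add: push_forward_simps)

lemma p_add:
  assumes "openin T U" "f \<in> I U" "g \<in> I U"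
  shows "p U (pr U (\<lambda>Q\<in>U. f Q + g Q)) = p U (pr U f) \<oplus>\<^bsub>Sec L (U \<inter> X)\<^esub> p U (pr U g)"
  unfolding quot_proj_add[OF I I2 assms]
  using module_sheaf_hom_add[OF hom assms(1) quot_proj_closed[OF I I2 assms(1,2)] quot_proj_closed[OF I I2 assms(1,3)]]
  by (simp add: push_forward_simps)

lemma p_smult:
  assumes "openin T U" "a \<in> regular n U" "f \<in> I U"
  shows "p U (pr U (\<lambda>Q\<in>U. a Q * f Q)) = restrict a (U \<inter> X) \<odot>\<^bsub>Sec L (U \<inter> X)\<^esub> p U (pr U f)"
  unfolding quot_proj_smult[OF I I2 assms]
  using module_sheaf_hom_smult[OF hom assms(1) _ quot_proj_closed[OF I I2 assms(1,3)], of a] assms(2)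
  by (simp add: push_forward_simps)

text \<open>\<open>module_sheaf_hom\<close> states additivity and linearity only; preservation of 0
  follows by writing the zero section as its own multiple by the zero function.\<close>

lemma p_zero:
  assumes U: "openin T U"
  shows "p U (pr U (\<lambda>Q\<in>U. 0)) = \<zero>\<^bsub>Sec L (U \<inter> X)\<^esub>"
proof -
  interpret M: Module.module "str_sheaf n (U \<inter> X)" "Sec L (U \<inter> X)" by (rule module_L[OF U])
  define z where "z = (\<lambda>Q\<in>U. 0 :: 'k)"
  have reg: "z \<in> regular n U"
    unfolding z_def using regular_const[of U n 0] openin_subset[OF U] by simp
  have zI: "z \<in> I U" unfolding z_def by (rule ideal_sheaf_zero[OF I U])
  have "(\<lambda>Q\<in>U. z Q * z Q) = z" unfolding z_def by (rule restrict_ext) simp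
  with p_smult[OF U reg zI] have "p U (pr U z) = restrict z (U \<inter> X) \<odot>\<^bsub>Sec L (U \<inter> X)\<^esub> p U (pr U z)"
    by (simp only:)
  also have "restrict z (U \<inter> X) = \<zero>\<^bsub>str_sheaf n (U \<inter> X)\<^esub>"
    unfolding zero_str_sheaf z_def by (auto simp: restrict_def)
  finally show ?thesis
    using M.smult_l_null[OF p_closed[OF U zI]] unfolding z_def by (simp only:)
qed

lemma J_I: "openin T U \<Longrightarrow> f \<in> J U \<Longrightarrow> f \<in> I U"
  by (simp add: mem_J_iff)

lemma J_zero: "openin T U \<Longrightarrow> (\<lambda>Q\<in>U. 0) \<in> J U"
  by (simp add: mem_J_iff p_zero ideal_sheaf_zero[OF I])

lemma J_add:
  assumes U: "openin T U" and f: "f \<in> J U" and g: "g \<in> J U"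
  shows "(\<lambda>Q\<in>U. f Q + g Q) \<in> J U"
proof -
  interpret M: Module.module "str_sheaf n (U \<inter> X)" "Sec L (U \<inter> X)" by (rule module_L[OF U])
  show ?thesis
    using f g by (simp add: mem_J_iff[OF U] p_add[OF U] ideal_sheaf_add[OF I U])
qed

lemma J_mult:
  assumes U: "openin T U" and a: "a \<in> regular n U" and f: "f \<in> J U"
  shows "(\<lambda>Q\<in>U. a Q * f Q) \<in> J U"
proof -
  interpret M: Module.module "str_sheaf n (U \<inter> X)" "Sec L (U \<inter> X)" by (rule module_L[OF U])
  have "restrict a (U \<inter> X) \<in> carrier (str_sheaf n (U \<inter> X))"
    using regular_restrict[OF a] by simp
  then show ?thesis
    using f by (simp add: mem_J_iff[OF U] p_smult[OF U a] ideal_sheaf_mult[OF I U a])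
qed

lemma J_square:
  assumes "openin T U" "f \<in> I U" "f \<in> I2 U"
  shows "f \<in> J U"
  unfolding mem_J_iff[OF assms(1)] quot_proj_eq_zero[OF I I2 assms(1,3)]
  using assms(2) p_zero[OF assms(1)] by simp

text \<open>
  If \<open>J\<close> were equal to \<open>I\<close> near a point of \<open>X\<close>, then \<open>p\<close> would vanish there, so the stalk of
  \<open>L\<close> would be 0.
\<close>

lemma J_not_locally_I:
  assumes P: "P \<in> X"
    and local: "\<And>V f. openin T V \<Longrightarrow> P \<in> V \<Longrightarrow> f \<in> I V \<Longrightarrow>
      \<exists>W. openin T W \<and> P \<in> W \<and> W \<subseteq> V \<and> restrict f W \<in> J W"
  shows False
proof -
  let ?TX = "subtopology T X"
  have "P \<in> topspace ?TX" using P X by auto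
  with L[unfolded line_bundle_def, THEN conjunct2] obtain W \<phi> where W: "openin ?TX W" "P \<in> W"
    and \<phi>: "module_sheaf_hom (subtopology ?TX W) (str_sheaf n) (free_rank_one (str_sheaf n)) L \<phi>"
    and bij: "\<And>U. openin (subtopology ?TX W) U \<Longrightarrow>
      bij_betw (\<phi> U) (carrier (Sec (free_rank_one (str_sheaf n)) U)) (carrier (Sec L U))"
    by blast
  obtain W' where W': "openin T W'" "W = W' \<inter> X" using W(1) unfolding openin_subtopology by blast
  have free_carrier: "carrier (Sec (free_rank_one (str_sheaf n)) U) = regular n U" for U :: "'k point set"
    by (simp add: free_rank_one_def)
  have free_smult: "a \<odot>\<^bsub>Sec (free_rank_one (str_sheaf n)) U\<^esub> s = (\<lambda>P\<in>U. a P * s P)"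
    for U :: "'k point set" and a s
    by (simp add: free_rank_one_def str_sheaf_def)
  have free_Res: "Res (free_rank_one (str_sheaf n)) U V s = restrict s V" for U V :: "'k point set" and s
    by (simp add: free_rank_one_def)
  have W_open: "openin (subtopology ?TX W) W" 
    unfolding openin_subtopology[of ?TX W W] using W(1) by blast
  have "W \<subseteq> proj_space n" using W' X by blast
  then have one: "(\<lambda>P\<in>W. 1) \<in> regular n W" by (rule regular_const)
  \<comment> \<open>The local generator of \<open>L\<close>, which will turn out to vanish near
    \<open>P\<close>.\<close>
  let ?t = "\<phi> W (\<lambda>P\<in>W. 1)"
  have t: "?t \<in> carrier (Sec L W)"
    using module_sheaf_hom_closed[OF \<phi> W_open] one by (simp add: free_carrier)
  have "\<exists>V s. openin T V \<and> P \<in> V \<and> V \<subseteq> W' \<and> s \<in> carrier (Sec conormal V) \<and>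
      p V s = Res L (W' \<inter> X) (V \<inter> X) ?t"
    using surj[unfolded surjective_sheaf_map_def push_forward_simps, rule_format, of W' ?t P] t W(2) W'
    by (simp only: Int_iff)
  then obtain V s where V: "openin T V" "P \<in> V" "V \<subseteq> W'" "s \<in> carrier (Sec conormal V)"
    and ps: "p V s = Res L W (V \<inter> X) ?t"
    unfolding W'(2)[symmetric] by blast
  \<comment> \<open>A section of the conormal sheaf comes from a function in \<open>I\<close> only
    locally. One more shrinking puts that function into \<open>J\<close>, so \<open>p\<close> kills
    its class.\<close>
  obtain V1 f where V1: "openin T V1" "P \<in> V1" "V1 \<subseteq> V" "f \<in> I V1" "Res conormal V V1 s = pr V1 f"
    by (rule quot_sections_locallyE[OF I I2 V(4,2)])
  obtain V2 where V2: "openin T V2" "P \<in> V2" "V2 \<subseteq> V1" "restrict f V2 \<in> J V2"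
    using local[OF V1(1,2,4)] by blast
  let ?U = "V2 \<inter> X"
  have UW: "?U \<subseteq> W" using V2(3) V1(3) V(3) W'(2) by blast
  then have U: "openin (subtopology ?TX W) ?U"
    unfolding openin_subtopology[of ?TX W ?U] using openin_inter_X[OF V2(1)] by blast
  interpret M: Module.module "str_sheaf n ?U" "Sec L ?U" by (rule module_L[OF V2(1)])
  have "\<zero>\<^bsub>Sec L ?U\<^esub> = p V2 (pr V2 (restrict f V2))"
    using V2(4) mem_J_iff[OF V2(1)] by simp
  also have "\<dots> = p V2 (Res conormal V1 V2 (pr V1 f))"
    by (simp only: quot_proj_restrict[OF I I2 V1(1) V2(1) V2(3) V1(4)])
  also have "\<dots> = Res L (V1 \<inter> X) ?U (p V1 (Res conormal V V1 s))"
    unfolding V1(5) module_sheaf_hom_Res[OF hom V1(1) V2(1,3) quot_proj_closed[OF I I2 V1(1,4)]]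
    by (simp only: push_forward_simps)
  also have "p V1 (Res conormal V V1 s) = Res L (V \<inter> X) (V1 \<inter> X) (Res L W (V \<inter> X) ?t)"
    unfolding module_sheaf_hom_Res[OF hom V(1) V1(1,3) V(4)] by (simp only: push_forward_simps ps)
  also have "\<dots> = Res L W (V1 \<inter> X) ?t"
    using V V1 W' by (intro is_module_sheaf_Res_trans[OF L_sheaf W(1) openin_inter_X openin_inter_X _ _ t]) auto
  also have "Res L (V1 \<inter> X) ?U (Res L W (V1 \<inter> X) ?t) = Res L W ?U ?t"
    using V V1 V2 W' by (intro is_module_sheaf_Res_trans[OF L_sheaf W(1) openin_inter_X openin_inter_X _ _ t]) auto
  also have "\<dots> = \<phi> ?U (restrict (\<lambda>P\<in>W. 1) ?U)"
    by (rule sym, rule module_sheaf_hom_Res[OF \<phi> W_open U UW, unfolded free_carrier free_Res, OF one])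
  finally have 1: "\<phi> ?U (restrict (\<lambda>P\<in>W. 1) ?U) = \<zero>\<^bsub>Sec L ?U\<^esub>" ..
  \<comment> \<open>The zero function also goes to 0 under \<open>\<phi>\<close>, again because it
    is its own multiple by 0. Injectivity of \<open>\<phi>\<close> then gives \<open>1 = 0\<close>
    on a set that contains \<open>P\<close>.\<close>
  define z where "z = (\<lambda>P\<in>?U. 0 :: 'k)"
  have zero_reg: "z \<in> regular n ?U"
    unfolding z_def by (rule regular_const) (use X in blast)
  have zz: "(\<lambda>P\<in>?U. z P * z P) = z" unfolding z_def by (rule restrict_ext) simp
  have "\<phi> ?U z = z \<odot>\<^bsub>Sec L ?U\<^esub> \<phi> ?U z"
    using module_sheaf_hom_smult[OF \<phi> U, of z z] zero_reg
    unfolding free_carrier free_smult carrier_str_sheaf zz by (simp only:)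
  also have "\<dots> = \<zero>\<^bsub>Sec L ?U\<^esub>"
    using M.smult_l_null[of "\<phi> ?U z"] module_sheaf_hom_closed[OF \<phi> U, of z] zero_reg
    unfolding free_carrier zero_str_sheaf z_def by (simp only:)
  finally have eq: "\<phi> ?U (restrict (\<lambda>P\<in>W. 1) ?U) = \<phi> ?U z" using 1 by (simp only:)
  have inj: "inj_on (\<phi> ?U) (regular n ?U)"
    using bij[OF U] unfolding bij_betw_def free_carrier by (rule conjunct1)
  have "restrict (\<lambda>P\<in>W. 1) ?U = z"
    by (rule inj_onD[OF inj eq regular_restrict[OF one UW] zero_reg])
  then have "restrict (\<lambda>P\<in>W. 1) ?U P = z P" by (rule fun_cong)
  then show False using P V2(2) W(2) by (simp add: z_def)
qed

section \<open>Forms in the homogeneous ideal\<close>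

lemma zero_twisted: "0 \<in> twisted_sections n J l"
proof -
  have "\<exists>h\<in>J U. \<forall>P\<in>U. \<forall>v\<in>P. h P = peval 0 v / peval g v" if "openin T U" for U g
    using J_zero[OF that] by (intro bexI[of _ "\<lambda>Q\<in>U. 0"]) auto
  then show ?thesis unfolding twisted_sections_def by simp
qed

text \<open>The section \<open>h\<close> promised by \<open>twisted_sections\<close> is determined
  pointwise; being extensional, it equals the quotient as a function.\<close>

lemma twisted_frac:
  assumes f: "f \<in> twisted_sections n J l" and U: "openin T U"
    and g: "g \<in> forms n l" "\<And>P. P \<in> U \<Longrightarrow> peval g (rep P) \<noteq> 0"
  shows "(\<lambda>P\<in>U. peval f (rep P) / peval g (rep P)) \<in> J U"
proof -
  have U': "P \<in> proj_space n" if "P \<in> U" for P using openin_subset[OF U] that by auto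
  have "peval g v \<noteq> 0" if "P \<in> U" "v \<in> P" for P v
    using peval_nonzero_iff[OF U'[OF that(1)] that(2) rep_mem[OF U'[OF that(1)]] g(1)] g(2)[OF that(1)] by simp
  then obtain h where h: "h \<in> J U" "\<forall>P\<in>U. \<forall>v\<in>P. h P = peval f v / peval g v"
    using f U g(1) unfolding twisted_sections_def by blast
  have "(\<lambda>P\<in>U. peval f (rep P) / peval g (rep P)) = restrict h U"
  proof (rule restrict_ext)
    fix P assume P: "P \<in> U"
    show "peval f (rep P) / peval g (rep P) = h P"
      using h(2)[rule_format, OF P rep_mem[OF U'[OF P]]] by (rule sym)
  qed
  also have "\<dots> = h"
    using J_I[OF U h(1)] unfolding vanishing_ideal_def
    by (intro extensional_restrict regular_extensional) blast
  finally show ?thesis using h(1) by simp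
qed

lemma restrict_mem_I:
  assumes "restrict F U \<in> regular n U" "\<And>P. P \<in> U \<Longrightarrow> P \<in> X \<Longrightarrow> F P = 0"
  shows "restrict F U \<in> I U"
  using assms by (simp add: vanishing_ideal_def)

lemma rep_coord_nonzero:
  assumes "P \<in> proj_space n"
  obtains i where "i \<le> n" "rep P i \<noteq> 0"
proof -
  have "rep P \<in> coords n" by (rule proj_point_subset_coords[OF assms rep_mem[OF assms]])
  then obtain i where i: "rep P i \<noteq> 0" and "\<forall>i>n. rep P i = 0" unfolding coords_def by blast
  then have "i \<le> n" by (meson not_le)
  then show thesis using i by (rule that)
qed

text \<open>On a chart \<open>X_i \<noteq> 0\<close> around \<open>P\<close> the quotient
  \<open>f / X_i^l\<close> is a section of \<open>J\<close>, hence of \<open>I\<close>.\<close>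

lemma twisted_vanish:
  assumes f: "f \<in> twisted_sections n J l" and P: "P \<in> X" "v \<in> P"
  shows "peval f v = 0"
proof -
  have P': "P \<in> proj_space n" using P X by blast
  then obtain i where i: "i \<le> n" "rep P i \<noteq> 0" by (rule rep_coord_nonzero)
  have form: "var i ^ l \<in> forms n l" "f \<in> forms n l"
    using forms_power[OF forms_var[OF i(1)], of l] f unfolding twisted_sections_def by simp_all
  let ?U = "basic_open n (var i ^ l :: 'k mpoly)"
  have U: "openin T ?U" by (rule openin_basic_open[OF form(1)])
  have mem: "Q \<in> ?U \<longleftrightarrow> Q \<in> proj_space n \<and> rep Q i ^ l \<noteq> 0" for Q
    unfolding mem_basic_open_iff[OF form(1)] by (simp add: peval_power)
  have "(\<lambda>Q\<in>?U. peval f (rep Q) / peval (var i ^ l) (rep Q)) \<in> I ?U"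
    by (rule J_I[OF U twisted_frac[OF f U form(1)]]) (simp add: mem peval_power)
  then have "\<forall>Q\<in>?U \<inter> X. (\<lambda>Q\<in>?U. peval f (rep Q) / peval (var i ^ l) (rep Q)) Q = 0"
    unfolding vanishing_ideal_def mem_Collect_eq by (rule conjunct2)
  moreover have PU: "P \<in> ?U" using P' i by (simp add: mem)
  ultimately have "(\<lambda>Q\<in>?U. peval f (rep Q) / peval (var i ^ l) (rep Q)) P = 0"
    using P(1) by blast
  then have "peval f (rep P) / peval (var i ^ l) (rep P) = 0" using PU by (simp only: restrict_apply')
  then have "peval f (rep P) = 0" using i by (simp add: peval_power)
  then show ?thesis using peval_nonzero_iff[OF P' P(2) rep_mem[OF P'] form(2)] by simp
qed

text \<open>Near each point \<open>f g / c\<close> is a product of two sections of \<open>I\<close>,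
  so it lies in the square of \<open>I\<close>, which dies in the conormal sheaf.\<close>

lemma mult_twisted:
  assumes f: "f \<in> forms n l" "\<And>P. P \<in> X \<Longrightarrow> peval f (rep P) = 0"
    and g: "g \<in> forms n l'" "\<And>P. P \<in> X \<Longrightarrow> peval g (rep P) = 0"
  shows "f * g \<in> twisted_sections n J (l + l')"
proof -
  have "\<forall>U c. openin T U \<and> c \<in> forms n (l + l') \<and> (\<forall>P\<in>U. \<forall>v\<in>P. peval c v \<noteq> 0) \<longrightarrow>
      (\<exists>h\<in>J U. \<forall>P\<in>U. \<forall>v\<in>P. h P = peval (f * g) v / peval c v)"
  proof (intro allI impI, elim conjE)
    fix U c assume U: "openin T U" and c: "c \<in> forms n (l + l')" and nz: "\<forall>P\<in>U. \<forall>v\<in>P. peval c v \<noteq> 0"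
    define h where "h = (\<lambda>P\<in>U. peval (f * g) (rep P) / peval c (rep P))"
    have U': "U \<subseteq> proj_space n" using openin_subset[OF U] by simp
    have nz': "peval c (rep P) \<noteq> 0" if "P \<in> U" for P
      by (rule nz[rule_format, OF that rep_mem[OF subsetD[OF U' that]]])
    have reg: "h \<in> regular n U"
      unfolding h_def by (rule regular_frac[OF U' forms_mult[OF f(1) g(1)] c nz'])
    then have hI: "h \<in> I U"
      unfolding h_def by (rule restrict_mem_I) (simp add: peval_mult f(2))
    have "h \<in> I2 U"
      unfolding ideal_square_def
    proof (intro CollectI conjI ballI reg)
      fix P assume P: "P \<in> U"
      obtain i where i: "i \<le> n" "rep P i \<noteq> 0" by (rule rep_coord_nonzero[OF subsetD[OF U' P]])
      let ?V = "U \<inter> basic_open n (var i :: 'k mpoly)"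
      have V: "openin T ?V" using U openin_basic_open[OF forms_var[OF i(1)]] by auto
      have V': "Q \<in> U" "rep Q i \<noteq> 0" if "Q \<in> ?V" for Q
        using that mem_basic_open_iff[OF forms_var[OF i(1)], of Q] by auto
      have xl: "var i ^ l \<in> forms n l"
        using forms_power[OF forms_var[OF i(1)], of l] by simp
      \<comment> \<open>Balance the degrees: \<open>f g / c\<close> is the product of
        \<open>f / X_i^l\<close> and \<open>X_i^l g / c\<close>, both of degree 0.\<close>
      let ?f = "\<lambda>Q\<in>?V. peval f (rep Q) / peval (var i ^ l) (rep Q)"
      let ?g = "\<lambda>Q\<in>?V. peval (var i ^ l * g) (rep Q) / peval c (rep Q)"
      have VP: "?V \<subseteq> proj_space n" using U' by blast
      have "?f \<in> regular n ?V"
        by (rule regular_frac[OF VP f(1) xl]) (use V' in \<open>simp add: peval_power\<close>)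
      then have "?f \<in> I ?V" by (rule restrict_mem_I) (simp add: f(2))
      moreover have "?g \<in> regular n ?V"
        by (rule regular_frac[OF VP forms_mult[OF xl g(1)] c]) (rule nz', erule V'(1))
      then have "?g \<in> I ?V" by (rule restrict_mem_I) (simp add: peval_mult g(2))
      ultimately have "?f \<otimes>\<^bsub>str_sheaf n ?V\<^esub> ?g \<in> ideal_prod (str_sheaf n ?V) (I ?V) (I ?V)"
        by (rule ideal_prod.prod)
      moreover have "?f \<otimes>\<^bsub>str_sheaf n ?V\<^esub> ?g = restrict h ?V"
      proof -
        have "?f \<otimes>\<^bsub>str_sheaf n ?V\<^esub> ?g = (\<lambda>Q\<in>?V. ?f Q * ?g Q)" by (simp add: str_sheaf_def)
        also have "\<dots> = restrict h ?V"
          by (rule restrict_ext) (use V' in \<open>simp add: h_def peval_mult peval_power\<close>)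
        finally show ?thesis .
      qed
      ultimately have "restrict h ?V \<in> ideal_prod (str_sheaf n ?V) (I ?V) (I ?V)" by simp
      moreover have "P \<in> ?V"
        using P subsetD[OF U' P] i by (simp add: mem_basic_open_iff[OF forms_var[OF i(1)]])
      ultimately show "\<exists>V. openin T V \<and> P \<in> V \<and> V \<subseteq> U \<and>
          restrict h V \<in> ideal_prod (str_sheaf n V) (I V) (I V)"
        using V by blast
    qed
    then have "h \<in> J U" by (rule J_square[OF U hI])
    moreover have "h P = peval (f * g) v / peval c v" if P: "P \<in> U" and v: "v \<in> P" for P v
    proof -
      have "P \<in> proj_space n" using U' P by blast
      from peval_ratio[OF this rep_mem[OF this] v forms_mult[OF f(1) g(1)] c]
      show ?thesis using P by (simp add: h_def)
    qed
    ultimately show "\<exists>h\<in>J U. \<forall>P\<in>U. \<forall>v\<in>P. h P = peval (f * g) v / peval c v"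
      by (intro bexI[of _ h] ballI)
  qed
  with forms_mult[OF f(1) g(1)] show ?thesis
    unfolding twisted_sections_def by (intro CollectI conjI)
qed

end

section \<open>The rational normal curve\<close>

text \<open>Euclid's argument: over a finite field, 1 plus the product of all \<open>x - a\<close>
  is a nonconstant polynomial without a root.\<close>

lemma infinite_UNIV_alg_closed: "infinite (UNIV :: 'k::alg_closed_field set)"
proof
  assume fin: "finite (UNIV :: 'k set)"
  define q where "q = (\<Prod>a\<in>(UNIV :: 'k set). [:- a, 1:])"
  have "degree q = (\<Sum>a\<in>(UNIV :: 'k set). degree [:- a, 1:])"
    unfolding q_def by (rule degree_prod_eq_sum_degree) simp
  also have "\<dots> = card (UNIV :: 'k set)" by simp
  also have "\<dots> > 0" using fin by (simp add: card_gt_0_iff)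
  finally have "degree q > 0" .
  then have "degree (q + 1) > 0" by (simp add: degree_add_eq_left)
  then obtain x where "poly (q + 1) x = 0" using alg_closed_imp_poly_has_root by blast
  moreover have "poly q x = 0"
    unfolding q_def poly_prod using fin by (intro prod_zero) auto
  ultimately show False by simp
qed

text \<open>Constants and variables generate the polynomial ring as a ring: one variable at a time
  is split off a monomial.\<close>

lemma poly_ring_induct [consumes 1, case_names const var add mult]:
  assumes "f \<in> poly_ring n" and const: "\<And>c. P (Poly_Mapping.single 0 c)"
    and var: "\<And>i. i \<le> n \<Longrightarrow> P (var i)"
    and add: "\<And>f g. P f \<Longrightarrow> P g \<Longrightarrow> P (f + g)" and mult: "\<And>f g. P f \<Longrightarrow> P g \<Longrightarrow> P (f * g)"
  shows "P f"
proof -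
  have single: "P (Poly_Mapping.single m c)" if "Poly_Mapping.keys m \<subseteq> {..n}" "mon_degree m = e" for m c e
    using that
  proof (induction e arbitrary: m)
    case 0
    then show ?case using const by (simp add: mon_degree_eq_0_iff)
  next
    case (Suc e)
    then have "m \<noteq> 0" by auto
    then obtain j where j: "j \<in> Poly_Mapping.keys m" by (metis all_not_in_conv keys_eq_empty)
    define m' where "m' = m - Poly_Mapping.single j 1"
    have m: "m = Poly_Mapping.single j 1 + m'"
      unfolding m'_def using j
      by (intro poly_mapping_eqI) (auto simp: lookup_add lookup_minus lookup_single when_def in_keys_iff)
    have "P (Poly_Mapping.single m' c)"
      by (rule Suc.IH) (use Suc.prems in \<open>auto simp: m keys_add_nat mon_degree_add\<close>)
    moreover have "P (var j)" using var j Suc.prems by auto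
    ultimately have "P (var j * Poly_Mapping.single m' c)" by (intro mult)
    then show ?case by (simp add: var_def mult_single m)
  qed
  have "P (\<Sum>m\<in>A. Poly_Mapping.single m (Poly_Mapping.lookup f m))"
    if "finite A" "A \<subseteq> Poly_Mapping.keys f" for A
    using that
  proof induction
    case empty
    then show ?case using const[of 0] by simp
  next
    case (insert m A)
    then have "Poly_Mapping.keys m \<subseteq> {..n}" using assms(1) by (auto simp: poly_ring_def)
    then show ?case using insert single[OF _ refl] by (auto intro: add)
  qed
  from this[of "Poly_Mapping.keys f"] show ?thesis by (simp flip: poly_mapping_eq_sum_single)
qed

section \<open>Restriction to the parametrised curve\<close>

definition weight :: "(nat \<Rightarrow>\<^sub>0 nat) \<Rightarrow> nat" where
  "weight m = (\<Sum>i\<in>Poly_Mapping.keys m. i * Poly_Mapping.lookup m i)"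

lemma weight_superset:
  assumes "finite A" "Poly_Mapping.keys m \<subseteq> A"
  shows "weight m = (\<Sum>i\<in>A. i * Poly_Mapping.lookup m i)"
  unfolding weight_def
  by (rule sum.mono_neutral_left) (use assms in \<open>auto simp: in_keys_iff\<close>)

lemma weight_add: "weight (m + m') = weight m + weight m'"
proof -
  let ?A = "Poly_Mapping.keys m \<union> Poly_Mapping.keys m'"
  show ?thesis
    by (subst (1 2 3) weight_superset[of ?A]) (auto simp: keys_add_nat lookup_add sum.distrib distrib_left)
qed

lemma weight_single [simp]: "weight (Poly_Mapping.single i e) = i * e"
  by (subst weight_superset[of "{i}"]) auto

lemma mon_eval_powers: "mon_eval m (\<lambda>i. t ^ i) = t ^ weight m"
  by (simp add: mon_eval_def weight_def power_sum power_mult)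

text \<open>The pullback of \<open>f\<close> along the affine parametrisation
  \<open>(1, t, t^2, ...)\<close>, where a monomial becomes \<open>t\<close> to the power of its
  weight.\<close>

definition curve_poly :: "'k::field mpoly \<Rightarrow> 'k poly" where
  "curve_poly f = (\<Sum>m\<in>Poly_Mapping.keys f. monom (Poly_Mapping.lookup f m) (weight m))"

lemma poly_curve_poly: "poly (curve_poly f) t = peval f (\<lambda>i. t ^ i)"
  by (simp add: curve_poly_def poly_sum poly_monom peval_alt mon_eval_powers)

text \<open>The truncation at \<open>d\<close> makes this a coordinate vector in projective
  \<open>d\<close>-space; these are the points of the curve with \<open>X_0 = 1\<close>.\<close>

definition moment :: "nat \<Rightarrow> 'k::field \<Rightarrow> nat \<Rightarrow> 'k" where
  "moment d t = (\<lambda>i. if i \<le> d then t ^ i else 0)"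

lemma peval_cong:
  assumes "f \<in> poly_ring n" "\<And>i. i \<le> n \<Longrightarrow> v i = w i"
  shows "peval f v = peval f w"
proof -
  have "mon_eval m v = mon_eval m w" if "m \<in> Poly_Mapping.keys f" for m
  proof -
    have "Poly_Mapping.keys m \<subseteq> {..n}" using assms(1) that unfolding poly_ring_def by blast
    then show ?thesis unfolding mon_eval_def using assms(2) by (intro prod.cong refl) (simp add: subset_iff)
  qed
  then show ?thesis unfolding peval_alt by simp
qed

lemma peval_moment: "f \<in> poly_ring d \<Longrightarrow> peval f (moment d t) = poly (curve_poly f) t"
  unfolding poly_curve_poly by (rule peval_cong) (auto simp: moment_def)

lemma moment_mem_curve: "proj_point (moment d t) \<in> rational_normal_curve d"
proof -
  define v :: "nat \<Rightarrow> 'a" where "v = (\<lambda>i. if i = 0 then 1 else if i = 1 then t else 0)"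
  have "v \<in> coords 1" unfolding v_def coords_def by (auto intro: exI[of _ 0])
  moreover have "moment d t = veronese d v" by (auto simp: moment_def veronese_def v_def)
  ultimately show ?thesis unfolding rational_normal_curve_def by (intro image_eqI[of _ _ v]) simp_all
qed

text \<open>The first and last coordinates are the \<open>d\<close>-th powers of \<open>v 0\<close>
  and \<open>v 1\<close>, which are not both 0.\<close>

lemma rational_normal_curve_subset: "rational_normal_curve d \<subseteq> proj_space d"
proof -
  have "veronese d v \<in> coords d" if v: "v \<in> coords 1" for v :: "nat \<Rightarrow> 'a"
  proof (cases "v 0 = 0")
    case False
    then have "veronese d v 0 \<noteq> 0" by (simp add: veronese_def)
    then show ?thesis unfolding coords_def by (auto simp: veronese_def)
  next
    case True
    obtain i where i: "v i \<noteq> 0" "\<forall>i>1. v i = 0" using v unfolding coords_def by blast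
    then have "\<not> i > 1" by blast
    then have "v 1 \<noteq> 0" using True i(1) by (cases "i = 0") (auto simp: le_Suc_eq not_less)
    then have "veronese d v d \<noteq> 0" by (simp add: veronese_def)
    then show ?thesis unfolding coords_def by (auto simp: veronese_def)
  qed
  then show ?thesis unfolding rational_normal_curve_def proj_space_def by blast
qed

lemma vanish_on_curve:
  assumes "f \<in> forms d l" "\<And>v. peval f (veronese d v) = 0" "P \<in> rational_normal_curve d"
  shows "peval f (rep P) = 0"
proof -
  obtain v where P: "P = proj_point (veronese d v)"
    using assms(3) unfolding rational_normal_curve_def by blast
  have "P \<in> proj_space d" using assms(3) rational_normal_curve_subset by blast
  from peval_nonzero_iff[OF this mem_proj_point[of "veronese d v", folded P] rep_mem[OF this] assms(1)]
  show ?thesis using assms(2) by simp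
qed

lemma mon_degree_1E:
  assumes "mon_degree m = 1"
  obtains j where "m = Poly_Mapping.single j 1"
proof -
  have "m \<noteq> 0" using assms by auto
  then obtain j where j: "j \<in> Poly_Mapping.keys m" by (metis all_not_in_conv keys_eq_empty)
  define m' where "m' = m - Poly_Mapping.single j 1"
  have m: "m = Poly_Mapping.single j 1 + m'"
    unfolding m'_def using j
    by (intro poly_mapping_eqI) (auto simp: lookup_add lookup_minus lookup_single when_def in_keys_iff)
  then have "mon_degree m' = 0" using assms by (simp add: mon_degree_add)
  then show thesis using that m by (simp add: mon_degree_eq_0_iff)
qed

lemma mon_degree_2E:
  assumes "mon_degree m = 2" "i \<in> Poly_Mapping.keys m"
  obtains j where "m = Poly_Mapping.single i 1 + Poly_Mapping.single j 1"
proof -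
  define m' where "m' = m - Poly_Mapping.single i 1"
  have m: "m = Poly_Mapping.single i 1 + m'"
    unfolding m'_def using assms(2)
    by (intro poly_mapping_eqI) (auto simp: lookup_add lookup_minus lookup_single when_def in_keys_iff)
  then have "mon_degree m' = 1" using assms by (simp add: mon_degree_add)
  then show thesis using that m by (metis mon_degree_1E)
qed

text \<open>\<open>X_0 X_j\<close> has weight \<open>j\<close>, at most \<open>d\<close>, and
  \<open>X_d X_j\<close> has weight \<open>d + j\<close>, at least \<open>d\<close>. The two ranges
  meet only in weight \<open>d\<close>, where both monomials are \<open>X_0 X_d\<close>.\<close>

lemma inj_on_weight:
  "inj_on weight {m. mon_degree m = 2 \<and> Poly_Mapping.keys m \<subseteq> {..d} \<and> Poly_Mapping.keys m \<inter> {0, d} \<noteq> {}}"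
proof -
  have *: "\<exists>i\<in>{0,d}. \<exists>j\<le>d. m = Poly_Mapping.single i 1 + Poly_Mapping.single j 1"
    if m: "mon_degree m = 2" "Poly_Mapping.keys m \<subseteq> {..d}" "Poly_Mapping.keys m \<inter> {0, d} \<noteq> {}" for m
  proof -
    obtain i where i: "i \<in> Poly_Mapping.keys m" "i \<in> {0,d}" using m(3) by blast
    obtain j where j: "m = Poly_Mapping.single i 1 + Poly_Mapping.single j 1"
      by (rule mon_degree_2E[OF m(1) i(1)])
    then have "j \<in> Poly_Mapping.keys m" by (simp add: keys_add_nat)
    then show ?thesis using m(2) i j by blast
  qed
  show ?thesis
  proof (rule inj_onI, elim CollectE conjE)
    fix m m' assume eq: "weight m = weight m'"
      and m: "mon_degree m = 2" "Poly_Mapping.keys m \<subseteq> {..d}" "Poly_Mapping.keys m \<inter> {0, d} \<noteq> {}"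
      and m': "mon_degree m' = 2" "Poly_Mapping.keys m' \<subseteq> {..d}" "Poly_Mapping.keys m' \<inter> {0, d} \<noteq> {}"
    obtain i j where ij: "i \<in> {0,d}" "j \<le> d" "m = Poly_Mapping.single i 1 + Poly_Mapping.single j 1"
      using *[OF m] by blast
    obtain i' j' where ij': "i' \<in> {0,d}" "j' \<le> d" "m' = Poly_Mapping.single i' 1 + Poly_Mapping.single j' 1"
      using *[OF m'] by blast
    have "i + j = i' + j'" using eq ij(3) ij'(3) by (simp add: weight_add)
    then have "i = i' \<and> j = j' \<or> i = j' \<and> j = i'" using ij(1,2) ij'(1,2) by auto
    then show "m = m'" using ij(3) ij'(3) by (auto simp: add.commute)
  qed
qed

text \<open>The monomials of \<open>r\<close> have distinct weights, so nothing cancels on the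
  curve: the coefficients of \<open>r\<close> reappear in \<open>curve_poly r\<close>, which is 0
  because the field is infinite.\<close>

lemma quadric_vanishing_on_curve_eq_zero:
  fixes r :: "'k::alg_closed_field mpoly"
  assumes r: "r \<in> forms d 2" "r \<in> var_ideal {0, d}" and vanish: "\<And>t. peval r (moment d t) = 0"
  shows "r = 0"
proof -
  have "curve_poly r = 0"
  proof (rule ccontr)
    assume "curve_poly r \<noteq> 0"
    then have "finite {t. poly (curve_poly r) t = 0}" by (rule poly_roots_finite)
    moreover have "{t. poly (curve_poly r) t = 0} = UNIV"
      using vanish peval_moment[OF forms_poly_ring[OF r(1)]] by auto
    ultimately show False using infinite_UNIV_alg_closed[where ?'k = 'k] by simp
  qed
  have inj: "inj_on weight (Poly_Mapping.keys r)"
    by (rule inj_on_subset[OF inj_on_weight[of d]])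
      (use r in \<open>auto simp: forms_def poly_ring_def var_ideal_def\<close>)
  have "Poly_Mapping.lookup r m = 0" for m
  proof (rule ccontr)
    assume "Poly_Mapping.lookup r m \<noteq> 0"
    then have m: "m \<in> Poly_Mapping.keys r" by (simp add: in_keys_iff)
    have "coeff (curve_poly r) (weight m)
        = (\<Sum>m'\<in>Poly_Mapping.keys r. if m' = m then Poly_Mapping.lookup r m' else 0)"
      unfolding curve_poly_def coeff_sum coeff_monom
      by (intro sum.cong refl) (use inj m in \<open>auto simp: inj_on_eq_iff\<close>)
    then show False using \<open>curve_poly r = 0\<close> \<open>Poly_Mapping.lookup r m \<noteq> 0\<close> m by simp
  qed
  then show ?thesis by (intro poly_mapping_eqI) simp
qed

section \<open>The minors in the homogeneous ideal\<close>

context double_str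
begin

lemma twisted_form: "f \<in> twisted_sections n J l \<Longrightarrow> f \<in> forms n l"
  unfolding twisted_sections_def mem_Collect_eq by (elim conjE)

text \<open>A form equals the component of its own degree in any decomposition into forms of
  distinct degrees.\<close>

lemma homogeneous_ideal_form:
  assumes "f \<in> homogeneous_ideal n J" "f \<in> forms n l"
  shows "f \<in> twisted_sections n J l"
proof -
  obtain A F where A: "finite A" "\<forall>l\<in>A. F l \<in> twisted_sections n J l" "f = (\<Sum>l\<in>A. F l)"
    using assms(1) unfolding homogeneous_ideal_def by blast
  \<comment> \<open>The value 0 covers a sum without a summand of degree \<open>l\<close>.\<close>
  define F' where "F' = (if l \<in> A then F l else 0)"
  have F': "F' \<in> twisted_sections n J l" using A(2) zero_twisted by (simp add: F'_def)
  have "Poly_Mapping.lookup f m = Poly_Mapping.lookup F' m" for m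
  proof (cases "mon_degree m = l")
    case True
    have "Poly_Mapping.lookup (F l') m = (if l' = l then Poly_Mapping.lookup F' m else 0)" if "l' \<in> A" for l'
    proof -
      have "F l' \<in> forms n l'" using A(2) that twisted_form by blast
      then show ?thesis using True that by (auto simp: F'_def forms_def in_keys_iff)
    qed
    then have "Poly_Mapping.lookup f m = (\<Sum>l'\<in>A. if l' = l then Poly_Mapping.lookup F' m else 0)"
      unfolding A(3) lookup_sum by (intro sum.cong refl)
    then show ?thesis using A(1) by (simp add: F'_def)
  next
    case False
    then have "m \<notin> Poly_Mapping.keys f" "m \<notin> Poly_Mapping.keys F'"
      using assms(2) twisted_form[OF F'] unfolding forms_def by blast+
    then show ?thesis by (simp add: in_keys_iff)
  qed
  then have "f = F'" by (rule poly_mapping_eqI)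
  then show ?thesis using F' by simp
qed

lemma twisted_homogeneous_ideal:
  assumes "f \<in> twisted_sections n J l"
  shows "f \<in> homogeneous_ideal n J"
proof -
  have "f = (\<Sum>l'\<in>{l}. f)" by simp
  then show ?thesis unfolding homogeneous_ideal_def using assms
    by (intro CollectI exI[of _ "{l}"] exI[of _ "\<lambda>_. f"]) simp
qed

end

locale rnc_double_str = double_str d "rational_normal_curve d" L p J
  for d :: nat and L :: "('k::alg_closed_field point, 'k, 'm) module_sheaf" and p J +
  assumes d: "d \<ge> 1"
begin

text \<open>On the curve \<open>a\<close> and \<open>b\<close> are both the \<open>d\<close>-th
  power of the coordinate \<open>X_r\<close>, so \<open>J\<close> contains \<open>(a - b)^2\<close>;
  the exponent is \<open>N = 2 d\<close>.\<close>

lemma var_power_mod_ideal: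
  assumes "r \<le> d" "r \<notin> {0, d}"
  shows "\<exists>N. \<exists>g\<in>homogeneous_ideal d J. g - var r ^ N \<in> var_ideal {0, d}"
proof -
  define a :: "'k mpoly" where "a = var r ^ d"
  define b :: "'k mpoly" where "b = var 0 ^ (d - r) * var d ^ r"
  have a: "a \<in> forms d d" using forms_power[OF forms_var[OF assms(1)], of d] by (simp add: a_def)
  have "b \<in> forms d ((d - r) * 1 + r * 1)"
    unfolding b_def by (intro forms_mult forms_power forms_var) auto
  then have b: "b \<in> forms d d" using assms by simp
  have ab: "a - b \<in> forms d d" by (rule forms_diff[OF a b])
  have "peval (a - b) (veronese d v) = 0" for v
  proof -
    have "(v 0 ^ (d - r) * v 1 ^ r) ^ d = (v 0 ^ d) ^ (d - r) * (v 1 ^ d) ^ r"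
      by (simp add: power_mult_distrib mult.commute flip: power_mult)
    then show ?thesis
      using assms by (simp add: a_def b_def peval_diff peval_mult peval_power veronese_def)
  qed
  then have "peval (a - b) (rep P) = 0" if "P \<in> rational_normal_curve d" for P
    using vanish_on_curve[OF ab _ that] by blast
  then have "(a - b) * (a - b) \<in> homogeneous_ideal d J"
    by (intro twisted_homogeneous_ideal[OF mult_twisted[OF ab _ ab]])
  moreover have "(a - b) * (a - b) - var r ^ (2 * d) \<in> var_ideal {0, d}"
  proof -
    \<comment> \<open>As \<open>r < d\<close>, a factor \<open>X_0\<close> can be taken out of
      \<open>b\<close>, so \<open>(a - b)^2\<close> and \<open>a^2\<close> agree modulo
      \<open>X_0\<close>.\<close>
    have "b = (var 0 ^ (d - r - 1) * var d ^ r) * var 0"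
      using assms power_minus_mult[of "d - r" "var 0 :: 'k mpoly"] by (simp add: b_def mult.commute mult.left_commute)
    then have "b \<in> var_ideal {0, d}" by (simp add: var_ideal_mult var_mem_var_ideal)
    then have "(b - a - a) * b \<in> var_ideal {0, d}" by (rule var_ideal_mult)
    also have "(b - a - a) * b = (a - b) * (a - b) - a * a" by (simp add: algebra_simps)
    also have "a * a = var r ^ (2 * d)" by (simp add: a_def power_add mult_2)
    finally show ?thesis .
  qed
  ultimately show ?thesis by blast
qed

text \<open>The second term of the minor is 0 modulo \<open>X_0\<close>. Hence the minor and the
  quadric \<open>g\<close> supplied by the resolution differ by a quadric in
  \<open>(X_0, X_d)\<close> that vanishes on the curve, that is, by 0.\<close>

lemma minor_twisted:
  assumes res: "quadrics_with_linear_syzygies d (homogeneous_ideal d J)" and i: "1 \<le> i" "i < d"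
  shows "var 1 * var i - var 0 * var (Suc i) \<in> twisted_sections d J 2"
proof -
  obtain b q A where "minimal_graded_free_resolution d (homogeneous_ideal d J) b (\<lambda>i j. i + 2) q A"
    using res unfolding quadrics_with_linear_syzygies_def by blast
  then interpret R: linear_quadric_resolution d "homogeneous_ideal d J" b q A
    by unfold_locales
  have form: "var j * var k \<in> (forms d 2 :: 'k mpoly set)" if "j \<le> d" "k \<le> d" for j k
    using forms_mult[OF forms_var[OF that(1)] forms_var[OF that(2)]] by (simp add: numeral_2_eq_2)
  have "var 1 * var i \<in> (forms d 2 :: 'k mpoly set)" using i by (intro form) auto
  then obtain g where g: "g \<in> homogeneous_ideal d J \<inter> forms d 2" "var 1 * var i - g \<in> var_ideal {0, d}"
    using R.quadric_in_ideal_mod_vars[of "{0, d}"] var_power_mod_ideal by (metis atMost_iff bot_nat_0.extremum empty_subsetI insert_subset order_refl)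
  then have gt: "g \<in> twisted_sections d J 2" using homogeneous_ideal_form by blast
  define r where "r = var 1 * var i - var 0 * var (Suc i) - g"
  have "r = 0"
  proof (rule quadric_vanishing_on_curve_eq_zero)
    show "r \<in> forms d 2" unfolding r_def using i g by (intro forms_diff form) auto
    have "r = (var 1 * var i - g) - var (Suc i) * var 0" by (simp add: r_def algebra_simps)
    then show "r \<in> var_ideal {0, d}"
      using g(2) by (simp add: var_ideal_diff var_ideal_mult var_mem_var_ideal)
    fix t
    have "peval g (moment d t) = 0"
      by (rule twisted_vanish[OF gt moment_mem_curve mem_proj_point])
    then show "peval r (moment d t) = 0"
      using i by (simp add: r_def peval_diff peval_mult moment_def)
  qed
  then have "g = var 1 * var i - var 0 * var (Suc i)" by (simp add: r_def)
  then show ?thesis using gt by simp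
qed

end

section \<open>Comparison of \<open>I\<close> and \<open>J\<close> on a chart\<close>

context double_str
begin

text \<open>This and the next three rules treat functions given by a formula, so that repeated sums
  and products do not nest restrictions.\<close>

lemma regular_restrict_add:
  assumes "restrict F W \<in> regular n W" "restrict G W \<in> regular n W"
  shows "(\<lambda>Q\<in>W. F Q + G Q) \<in> regular n W"
proof -
  have "(\<lambda>Q\<in>W. F Q + G Q) = (\<lambda>Q\<in>W. restrict F W Q + restrict G W Q)" by (rule restrict_ext) simp
  then show ?thesis using regular_add[OF assms] by (simp only:)
qed

lemma regular_restrict_mult:
  assumes "restrict F W \<in> regular n W" "restrict G W \<in> regular n W"
  shows "(\<lambda>Q\<in>W. F Q * G Q) \<in> regular n W"
proof -
  have "(\<lambda>Q\<in>W. F Q * G Q) = (\<lambda>Q\<in>W. restrict F W Q * restrict G W Q)" by (rule restrict_ext) simp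
  then show ?thesis using regular_mult[OF assms] by (simp only:)
qed

lemma J_restrict_add:
  assumes "openin T W" "restrict F W \<in> J W" "restrict G W \<in> J W"
  shows "(\<lambda>Q\<in>W. F Q + G Q) \<in> J W"
proof -
  have "(\<lambda>Q\<in>W. F Q + G Q) = (\<lambda>Q\<in>W. restrict F W Q + restrict G W Q)" by (rule restrict_ext) simp
  then show ?thesis using J_add[OF assms] by (simp only:)
qed

lemma J_restrict_mult:
  assumes "openin T W" "restrict F W \<in> regular n W" "restrict G W \<in> J W"
  shows "(\<lambda>Q\<in>W. F Q * G Q) \<in> J W"
proof -
  have "(\<lambda>Q\<in>W. F Q * G Q) = (\<lambda>Q\<in>W. restrict F W Q * restrict G W Q)" by (rule restrict_ext) simp
  then show ?thesis using J_mult[OF assms] by (simp only:)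
qed

end

context rnc_double_str
begin

text \<open>
  On the chart \<open>X\<^sub>0 \<noteq> 0\<close> with coordinates \<open>y\<^sub>i = X\<^sub>i / X\<^sub>0\<close>, the minors give \<open>y\<^sub>i\<^sub>+\<^sub>1 - y\<^sub>1 y\<^sub>i \<in> J\<close>, so
  modulo \<open>J\<close> every \<open>y\<^sub>i\<close> may be replaced by a power of \<open>y\<^sub>1\<close>.
\<close>

lemma affine_mod_J:
  assumes minors: "\<And>i. 1 \<le> i \<Longrightarrow> i < d \<Longrightarrow> var 1 * var i - var 0 * var (Suc i) \<in> twisted_sections d J 2"
    and W: "openin T W" and nz: "\<And>Q. Q \<in> W \<Longrightarrow> rep Q 0 \<noteq> 0"
    and a: "a \<in> poly_ring d"
  defines "y \<equiv> \<lambda>Q i. rep Q i / rep Q 0"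
  shows "(\<lambda>Q\<in>W. peval a (y Q) - peval a (\<lambda>i. y Q 1 ^ i)) \<in> J W"
proof -
  have WP: "W \<subseteq> proj_space d" using openin_subset[OF W] by simp
  have const: "(\<lambda>Q\<in>W. c) \<in> regular d W" for c by (rule regular_const[OF WP])
  have y: "(\<lambda>Q\<in>W. y Q i) \<in> regular d W" if "i \<le> d" for i
    using regular_frac[OF WP forms_var[OF that] forms_var[of 0 d]] nz unfolding y_def peval_var by blast
  have y1: "(\<lambda>Q\<in>W. y Q 1) \<in> regular d W" by (rule y[OF d])
  have pow: "(\<lambda>Q\<in>W. y Q 1 ^ i) \<in> regular d W" for i
  proof (induction i)
    case 0
    show ?case unfolding power_0 by (rule const)
  next
    case (Suc i)
    show ?case unfolding power_Suc by (rule regular_restrict_mult[OF y1 Suc])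
  qed
  have minor: "(\<lambda>Q\<in>W. y Q 1 * y Q i - y Q (Suc i)) \<in> J W" if "1 \<le> i" "i < d" for i
  proof -
    have x0: "var 0 * var 0 \<in> (forms d 2 :: 'k mpoly set)"
      using forms_mult[OF forms_var forms_var, of 0 d 0] by (simp add: numeral_2_eq_2)
    have "(\<lambda>Q\<in>W. peval (var 1 * var i - var 0 * var (Suc i)) (rep Q) / peval (var 0 * var 0) (rep Q)) \<in> J W"
      by (rule twisted_frac[OF minors[OF that] W x0]) (simp add: peval_mult nz)
    also have "(\<lambda>Q\<in>W. peval (var 1 * var i - var 0 * var (Suc i)) (rep Q) / peval (var 0 * var 0) (rep Q))
        = (\<lambda>Q\<in>W. y Q 1 * y Q i - y Q (Suc i))"
      by (rule restrict_ext) (simp add: peval_mult peval_diff y_def nz field_simps)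
    finally show ?thesis .
  qed
  have diff: "(\<lambda>Q\<in>W. y Q i - y Q 1 ^ i) \<in> J W" if "i \<le> d" for i
    using that
  proof (induction i)
    case 0
    have "(\<lambda>Q\<in>W. y Q 0 - y Q 1 ^ 0) = (\<lambda>Q\<in>W. 0)" by (rule restrict_ext) (simp add: y_def nz)
    then show ?case using J_zero[OF W] by (simp only:)
  next
    case (Suc i)
    show ?case
    \<comment> \<open>The minors begin at \<open>i = 1\<close>; passing from 0 to 1 is
      trivial.\<close>
    proof (cases "i = 0")
      case True
      have "(\<lambda>Q\<in>W. y Q (Suc i) - y Q 1 ^ Suc i) = (\<lambda>Q\<in>W. 0)" by (rule restrict_ext) (simp add: True)
      then show ?thesis using J_zero[OF W] by (simp only:)
    next
      case False
      \<comment> \<open>The minor exchanges \<open>y_(i+1)\<close> for \<open>y_1 y_i\<close>, then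
        the induction hypothesis exchanges \<open>y_i\<close> for \<open>y_1^i\<close>.\<close>
      have 1: "(\<lambda>Q\<in>W. - 1 * (y Q 1 * y Q i - y Q (Suc i))) \<in> J W"
        by (rule J_restrict_mult[OF W const minor]) (use False Suc.prems in auto)
      have 2: "(\<lambda>Q\<in>W. y Q 1 * (y Q i - y Q 1 ^ i)) \<in> J W"
        by (rule J_restrict_mult[OF W y1 Suc.IH]) (use Suc.prems in auto)
      have "(\<lambda>Q\<in>W. y Q (Suc i) - y Q 1 ^ Suc i)
          = (\<lambda>Q\<in>W. - 1 * (y Q 1 * y Q i - y Q (Suc i)) + y Q 1 * (y Q i - y Q 1 ^ i))"
        by (rule restrict_ext) (simp add: algebra_simps)
      then show ?thesis using J_restrict_add[OF W 1 2] by (simp only:)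
    qed
  qed
  \<comment> \<open>Regularity of both substitutions is carried along, because the product case
    multiplies sections of \<open>J\<close> by them.\<close>
  have "(\<lambda>Q\<in>W. peval a (y Q)) \<in> regular d W \<and> (\<lambda>Q\<in>W. peval a (\<lambda>i. y Q 1 ^ i)) \<in> regular d W \<and>
      (\<lambda>Q\<in>W. peval a (y Q) - peval a (\<lambda>i. y Q 1 ^ i)) \<in> J W"
    using a
  proof (induction rule: poly_ring_induct)
    case (const c)
    show ?case unfolding peval_single mon_eval_zero mult_1_right diff_self
      by (intro conjI regular_const[OF WP] J_zero[OF W])
  next
    case (var i)
    show ?case unfolding peval_var by (intro conjI y[OF var] pow diff[OF var])
  next
    case (add f g)
    let ?f = "\<lambda>Q. peval f (y Q)" and ?g = "\<lambda>Q. peval g (y Q)"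
    let ?f' = "\<lambda>Q. peval f (\<lambda>i. y Q 1 ^ i)" and ?g' = "\<lambda>Q. peval g (\<lambda>i. y Q 1 ^ i)"
    have "(\<lambda>Q\<in>W. (?f Q - ?f' Q) + (?g Q - ?g' Q)) \<in> J W"
      using add by (intro J_restrict_add[OF W]; elim conjE)
    moreover have "(\<lambda>Q\<in>W. (?f Q - ?f' Q) + (?g Q - ?g' Q)) = (\<lambda>Q\<in>W. (?f Q + ?g Q) - (?f' Q + ?g' Q))"
      by (rule restrict_ext) simp
    moreover have "(\<lambda>Q\<in>W. ?f Q + ?g Q) \<in> regular d W"
      using add by (intro regular_restrict_add; elim conjE)
    moreover have "(\<lambda>Q\<in>W. ?f' Q + ?g' Q) \<in> regular d W"
      using add by (intro regular_restrict_add; elim conjE)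
    ultimately show ?case unfolding peval_add by (intro conjI) (simp_all only:)
  next
    case (mult f g)
    let ?f = "\<lambda>Q. peval f (y Q)" and ?g = "\<lambda>Q. peval g (y Q)"
    let ?f' = "\<lambda>Q. peval f (\<lambda>i. y Q 1 ^ i)" and ?g' = "\<lambda>Q. peval g (\<lambda>i. y Q 1 ^ i)"
    have 1: "(\<lambda>Q\<in>W. ?f Q * (?g Q - ?g' Q)) \<in> J W"
      using mult by (intro J_restrict_mult[OF W]; elim conjE)
    have 2: "(\<lambda>Q\<in>W. ?g' Q * (?f Q - ?f' Q)) \<in> J W"
      using mult by (intro J_restrict_mult[OF W]; elim conjE)
    have "(\<lambda>Q\<in>W. ?f Q * ?g Q - ?f' Q * ?g' Q) = (\<lambda>Q\<in>W. ?f Q * (?g Q - ?g' Q) + ?g' Q * (?f Q - ?f' Q))"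
      by (rule restrict_ext) (simp add: algebra_simps)
    then have "(\<lambda>Q\<in>W. ?f Q * ?g Q - ?f' Q * ?g' Q) \<in> J W"
      using J_restrict_add[OF W 1 2] by (simp only:)
    moreover have "(\<lambda>Q\<in>W. ?f Q * ?g Q) \<in> regular d W"
      using mult by (intro regular_restrict_mult; elim conjE)
    moreover have "(\<lambda>Q\<in>W. ?f' Q * ?g' Q) \<in> regular d W"
      using mult by (intro regular_restrict_mult; elim conjE)
    ultimately show ?case unfolding peval_mult by (intro conjI)
  qed
  then show ?thesis by (elim conjE)
qed

text \<open>At \<open>[1:0:...:0]\<close> every germ of \<open>I\<close> is shown to lie in
  \<open>J\<close>. Modulo \<open>J\<close> the dehomogenised numerator depends only on its
  restriction to the curve, and that restriction is 0.\<close>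

lemma not_quadrics_with_linear_syzygies: "\<not> quadrics_with_linear_syzygies d (homogeneous_ideal d J)"
proof
  assume res: "quadrics_with_linear_syzygies d (homogeneous_ideal d J)"
  define P :: "'k point" where "P = proj_point (moment d 0)"
  have PX: "P \<in> rational_normal_curve d" unfolding P_def by (rule moment_mem_curve)
  then have PP: "P \<in> proj_space d" using rational_normal_curve_subset by blast
  have PM: "moment d 0 \<in> P" unfolding P_def by (rule mem_proj_point)
  have x0: "var 0 \<in> (forms d 1 :: 'k mpoly set)" by (rule forms_var) simp
  have "rep P 0 \<noteq> 0"
    using peval_nonzero_iff[OF PP PM rep_mem[OF PP] x0]
    by (simp add: moment_def)
  then have P0: "P \<in> basic_open d (var 0)" unfolding mem_basic_open_iff[OF x0] using PP by simp
  show False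
  proof (rule J_not_locally_I[OF PX])
    fix V f assume V: "openin T V" "P \<in> V" and f: "f \<in> I V"
    have f_reg: "f \<in> regular d V" and f_van: "\<And>Q. Q \<in> V \<Longrightarrow> Q \<in> rational_normal_curve d \<Longrightarrow> f Q = 0"
      using f unfolding vanishing_ideal_def by auto
    obtain N a l b where N: "openin T N" "P \<in> N" and a: "a \<in> forms d l" and b: "b \<in> forms d l"
      and ab: "\<forall>Q v. Q \<in> N \<longrightarrow> Q \<in> V \<longrightarrow> v \<in> Q \<longrightarrow> peval b v \<noteq> 0 \<and> f Q = peval a v / peval b v"
      by (rule regularE[OF f_reg V(2)])
    define W where "W = N \<inter> V \<inter> basic_open d (var 0)"
    have W: "openin T W" unfolding W_def using V N openin_basic_open[OF x0] by auto
    have PW: "P \<in> W" unfolding W_def using V N P0 by blast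
    have WP: "W \<subseteq> proj_space d" using openin_subset[OF W] by simp
    have nz: "rep Q 0 \<noteq> 0" if "Q \<in> W" for Q
      using that mem_basic_open_iff[OF x0, of Q] by (simp add: W_def)
    obtain l' g where g: "g \<in> forms d l'" "P \<in> basic_open d g" "basic_open d g \<subseteq> W"
      by (rule openin_zariskiE[OF W PW])
    \<comment> \<open>The numerator \<open>a\<close> vanishes only at curve points known to lie in
      \<open>W\<close>; the factor \<open>g\<close> vanishes at all others, so the product vanishes
      for every \<open>t\<close>.\<close>
    have ag: "poly (curve_poly a * curve_poly g) t = 0" for t
    proof (rule ccontr)
      assume "poly (curve_poly a * curve_poly g) t \<noteq> 0"
      then have nza: "peval a (moment d t) \<noteq> 0" and nzg: "peval g (moment d t) \<noteq> 0"
        by (auto simp: peval_moment[OF forms_poly_ring[OF a]] peval_moment[OF forms_poly_ring[OF g(1)]])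
      define Q :: "'k point" where "Q = proj_point (moment d t)"
      have tQ: "moment d t \<in> Q" unfolding Q_def by (rule mem_proj_point)
      have QX: "Q \<in> rational_normal_curve d" unfolding Q_def by (rule moment_mem_curve)
      then have QP: "Q \<in> proj_space d" using rational_normal_curve_subset by blast
      have "peval g (rep Q) \<noteq> 0"
        using peval_nonzero_iff[OF QP tQ rep_mem[OF QP] g(1)] nzg by simp
      then have "Q \<in> W" using QP mem_basic_open_iff[OF g(1), of Q] g(3) by blast
      then have Q: "Q \<in> N" "Q \<in> V" by (simp_all add: W_def)
      have "f Q \<noteq> 0" using ab[rule_format, OF Q tQ] nza by simp
      then show False using f_van[OF Q(2) QX] by simp
    qed
    have "curve_poly a * curve_poly g = 0"
    proof (rule ccontr)
      assume "curve_poly a * curve_poly g \<noteq> 0"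
      then have "finite {t. poly (curve_poly a * curve_poly g) t = 0}" by (rule poly_roots_finite)
      then show False using infinite_UNIV_alg_closed[where ?'k = 'k] by (simp only: ag simp_thms Collect_const if_True)
    qed
    \<comment> \<open>\<open>P\<close> is the point with parameter 0, and \<open>g\<close> is
      nonzero there. Polynomials in \<open>t\<close> have no zero divisors, so \<open>a\<close>
      vanishes on the whole parametrised curve.\<close>
    moreover have "curve_poly g \<noteq> 0"
    proof
      assume "curve_poly g = 0"
      then have "peval g (moment d 0) = 0" by (simp add: peval_moment[OF forms_poly_ring[OF g(1)]])
      then have "peval g (rep P) = 0"
        using peval_nonzero_iff[OF PP PM rep_mem[OF PP] g(1)] by simp
      then show False using g(2) mem_basic_open_iff[OF g(1), of P] by blast
    qed
    ultimately have a0: "curve_poly a = 0" by simp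
    define y where "y = (\<lambda>Q i. rep Q i / rep Q 0 :: 'k)"
    have "(\<lambda>Q\<in>W. peval a (y Q) - peval a (\<lambda>i. y Q 1 ^ i)) \<in> J W"
      unfolding y_def by (rule affine_mod_J[OF minor_twisted[OF res] W nz forms_poly_ring[OF a]])
    \<comment> \<open>The subtracted term is the value of \<open>curve_poly a\<close> at
      \<open>y Q 1\<close>.\<close>
    also have "(\<lambda>Q\<in>W. peval a (y Q) - peval a (\<lambda>i. y Q 1 ^ i)) = (\<lambda>Q\<in>W. peval a (y Q))"
      by (rule restrict_ext) (simp add: a0 flip: poly_curve_poly)
    finally have aJ: "(\<lambda>Q\<in>W. peval a (y Q)) \<in> J W" .
    have b_nz: "peval b (rep Q) \<noteq> 0" and f_eq: "f Q = peval a (rep Q) / peval b (rep Q)" if "Q \<in> W" for Q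
      using ab[rule_format, of Q "rep Q"] that rep_mem[OF subsetD[OF WP that]] by (simp_all add: W_def)
    \<comment> \<open>Homogeneity of \<open>a\<close> turns \<open>f = a / b\<close> into the
      regular function \<open>X_0^l / b\<close> times the dehomogenised numerator.\<close>
    have "(\<lambda>Q\<in>W. peval (var 0 ^ l) (rep Q) / peval b (rep Q)) \<in> regular d W"
      using forms_power[OF x0, of l] by (intro regular_frac[OF WP _ b b_nz]) simp_all
    from J_restrict_mult[OF W this aJ]
    have "(\<lambda>Q\<in>W. peval (var 0 ^ l) (rep Q) / peval b (rep Q) * peval a (y Q)) \<in> J W" .
    also have "(\<lambda>Q\<in>W. peval (var 0 ^ l) (rep Q) / peval b (rep Q) * peval a (y Q)) = restrict f W"
    proof (rule restrict_ext)
      fix Q assume Q: "Q \<in> W"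
      have "rep Q = (\<lambda>i. rep Q 0 * y Q i)" using nz[OF Q] by (simp add: y_def)
      then have "peval a (rep Q) = rep Q 0 ^ l * peval a (y Q)"
        using peval_scale[OF a, of "rep Q 0" "y Q"] by simp
      then show "peval (var 0 ^ l) (rep Q) / peval b (rep Q) * peval a (y Q) = f Q"
        by (simp add: f_eq[OF Q] peval_power)
    qed
    finally have "restrict f W \<in> J W" .
    moreover have "W \<subseteq> V" unfolding W_def by blast
    ultimately show "\<exists>W. openin T W \<and> P \<in> W \<and> W \<subseteq> V \<and> restrict f W \<in> J W"
      using W PW by (intro exI[of _ W] conjI)
  qed
qed

end

theorem lemma3:
  fixes d :: nat
  assumes "d \<ge> 1"
  shows "\<not> (\<exists>(L :: ('k::alg_closed_field point, 'k, 'm) module_sheaf) p J.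
    double_structure d (rational_normal_curve d) L p J \<and>
    quadrics_with_linear_syzygies d (homogeneous_ideal d J))"
proof
  assume "\<exists>(L :: ('k point, 'k, 'm) module_sheaf) p J.
    double_structure d (rational_normal_curve d) L p J \<and>
    quadrics_with_linear_syzygies d (homogeneous_ideal d J)"
  then obtain L :: "('k point, 'k, 'm) module_sheaf" and p J
    where ds: "double_structure d (rational_normal_curve d) L p J"
      and res: "quadrics_with_linear_syzygies d (homogeneous_ideal d J)"
    by (elim exE conjE)
  interpret rnc_double_str d L p J
    by unfold_locales (use ds assms rational_normal_curve_subset in simp_all)
  show False using not_quadrics_with_linear_syzygies res by contradiction
qed

end
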